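(* Let $\underline{\theta}^N=\min_{k\in[K]}\frac{|\Gamma^N_k|}{|\Gamma^N|}\theta_k$ and $\overline{\theta}^N=\max_{k\in[K]}\theta_k$. Then $$\mathscr{W}_{\underline{\theta}^N}\big(\widehat{\mathbb{P}}^N\big)\subseteq\mathscr{B}(\Gamma^N)\subseteq\mathscr{W}_{\overline{\theta}^N}\big(\widehat{\mathbb{P}}^N\big).$$
   Context: $[N]=\{1,\dots,N\}$, $\varXi\subseteq\mathbb{R}^m$ is the support set of the uncertainty, $\mathscr{P}(\varXi)$ is the set of all Borel probability measures supported on $\varXi$, and $\|\cdot\|$ is a norm on $\mathbb{R}^m$. The Wasserstein metric is $d_W(\mathbb{Q},\mathbb{P})=\inf_{\pi\in\Pi(\mathbb{Q},\mathbb{P})}\int_{\varXi\times\varXi}\|\boldsymbol{x}-\boldsymbol{y}\|\,d\pi(\boldsymbol{x},\boldsymbol{y})$, where $\Pi(\mathbb{Q},\mathbb{P})$ is the set of probability measures on $\varXi\times\varXi$ with marginals $\mathbb{Q}$ and $\mathbb{P}$. For $\theta\ge0$ and $\mathbb{P}\in\mathscr{P}(\varXi)$, the Wasserstein ball is $\mathscr{W}_\theta(\mathbb{P})=\{\mathbb{Q}\in\mathscr{P}(\varXi): d_W(\mathbb{Q},\mathbb{P})\le\theta\}$. $\Gamma^N$ is the collection of $N$ data points $\widehat{\boldsymbol{w}}_l\in\varXi$, $l\in[N]$ (counted with multiplicity, so $|\Gamma^N|=N$), with empirical distribution $\widehat{\mathbb{P}}^N=\frac1N\sum_{l\in[N]}\delta_{\widehat{\boldsymbol{w}}_l}$.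 The data are partitioned by a clustering rule into $K$ nonempty clusters $\Gamma^N_k$, $k\in[K]$ (in the paper the rule is given by the maximum-posterior labels of a Dirichlet process mixture model; any partition is allowed here). The local empirical distributions are $\widehat{\mathbb{P}}^N_k=\frac1{|\Gamma^N_k|}\sum_{\widehat{\boldsymbol{w}}\in\Gamma^N_k}\delta_{\widehat{\boldsymbol{w}}}$, and $\theta_k>0$ is the Wasserstein radius of cluster $k$. The data-driven ambiguity set is the weighted Minkowski sum $$\mathscr{B}(\Gamma^N)=\bigoplus_{k=1}^K\frac{|\Gamma^N_k|}{|\Gamma^N|}\mathscr{W}_{\theta_k}\big(\widehat{\mathbb{P}}^N_k\big)=\Big\{\sum_{k=1}^K\frac{|\Gamma^N_k|}{|\Gamma^N|}\mathbb{Q}_k:\ \mathbb{Q}_k\in\mathscr{W}_{\theta_k}(\widehat{\mathbb{P}}^N_k),\ k\in[K]\Big\}.$$ *)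

theory Defs
  imports "HOL-Probability.Probability"
begin

(* An arbitrary norm on a real vector space; the type class norm on real ^ 'm would only give
   the Euclidean one. *)
definition is_norm :: "('a::real_vector \<Rightarrow> real) \<Rightarrow> bool" where
  "is_norm nrm \<longleftrightarrow>
     (\<forall>x. 0 \<le> nrm x) \<and>
     (\<forall>x. nrm x = 0 \<longleftrightarrow> x = 0) \<and>
     (\<forall>c x. nrm (c *\<^sub>R x) = \<bar>c\<bar> * nrm x) \<and>
     (\<forall>x y. nrm (x + y) \<le> nrm x + nrm y)"

abbreviation borel_on :: "'a::topological_space set \<Rightarrow> 'a measure" where
  "borel_on \<Xi> \<equiv> restrict_space borel \<Xi>"

(* Measures supported on \<Xi> live on \<Xi> with its trace Borel sigma-algebra, so \<Xi> itself need not
   be Borel. If it is, these are the Borel probability measures Q on the whole space with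
   Q(\<Xi>) = 1. *)
definition prob_measures :: "'a::topological_space set \<Rightarrow> 'a measure set" where
  "prob_measures \<Xi> = {Q. prob_space Q \<and> sets Q = sets (borel_on \<Xi>)}"

definition couplings ::
  "'a::topological_space set \<Rightarrow> 'a measure \<Rightarrow> 'a measure \<Rightarrow> ('a \<times> 'a) measure set" where
  "couplings \<Xi> Q P = {\<pi>. prob_space \<pi> \<and> sets \<pi> = sets (borel_on \<Xi> \<Otimes>\<^sub>M borel_on \<Xi>) \<and>
     distr \<pi> (borel_on \<Xi>) fst = Q \<and> distr \<pi> (borel_on \<Xi>) snd = P}"

(* Extended-valued: no moment condition is imposed, so the distance can be infinite. *)
definition wasserstein ::
  "'a::real_normed_vector set \<Rightarrow> ('a \<Rightarrow> real) \<Rightarrow> 'a measure \<Rightarrow> 'a measure \<Rightarrow> ennreal" where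
  "wasserstein \<Xi> nrm Q P =
     (INF \<pi> \<in> couplings \<Xi> Q P. \<integral>\<^sup>+ z. ennreal (nrm (fst z - snd z)) \<partial>\<pi>)"

definition wasserstein_ball ::
  "'a::real_normed_vector set \<Rightarrow> ('a \<Rightarrow> real) \<Rightarrow> real \<Rightarrow> 'a measure \<Rightarrow> 'a measure set" where
  "wasserstein_ball \<Xi> nrm \<theta> P = {Q \<in> prob_measures \<Xi>. wasserstein \<Xi> nrm Q P \<le> ennreal \<theta>}"

definition weighted_sum ::
  "'a measure \<Rightarrow> 'i set \<Rightarrow> ('i \<Rightarrow> real) \<Rightarrow> ('i \<Rightarrow> 'a measure) \<Rightarrow> 'a measure" where
  "weighted_sum M I a Q =
     measure_of (space M) (sets M) (\<lambda>A. \<Sum>i\<in>I. ennreal (a i) * emeasure (Q i) A)"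

lemma sets_weighted_sum [simp]: "sets (weighted_sum M I a Q) = sets M"
  and space_weighted_sum [simp]: "space (weighted_sum M I a Q) = space M"
  by (simp_all add: weighted_sum_def)

lemma emeasure_weighted_sum:
  assumes "\<And>i. i \<in> I \<Longrightarrow> sets (Q i) = sets M" and A: "A \<in> sets M"
  shows "emeasure (weighted_sum M I a Q) A = (\<Sum>i\<in>I. ennreal (a i) * emeasure (Q i) A)"
proof (rule emeasure_measure_of[OF weighted_sum_def])
  show "sets M \<subseteq> Pow (space M)" by (rule sets.space_closed)
  show "A \<in> sets (weighted_sum M I a Q)" using A by simp
  show "positive (sets (weighted_sum M I a Q)) (\<lambda>A. \<Sum>i\<in>I. ennreal (a i) * emeasure (Q i) A)"
    by (simp add: positive_def)
  show "countably_additive (sets (weighted_sum M I a Q))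
          (\<lambda>A. \<Sum>i\<in>I. ennreal (a i) * emeasure (Q i) A)"
  proof (rule countably_additiveI)
    fix B :: "nat \<Rightarrow> _"
    assume B: "range B \<subseteq> sets (weighted_sum M I a Q)" "disjoint_family B"
    have "(\<Sum>n. \<Sum>i\<in>I. ennreal (a i) * emeasure (Q i) (B n))
        = (\<Sum>i\<in>I. \<Sum>n. ennreal (a i) * emeasure (Q i) (B n))"
      by (rule suminf_sum) simp
    also have "\<dots> = (\<Sum>i\<in>I. ennreal (a i) * emeasure (Q i) (\<Union>n. B n))"
    proof (rule sum.cong)
      fix i assume "i \<in> I"
      then have "range B \<subseteq> sets (Q i)" using assms(1) B(1) by simp
      then show "(\<Sum>n. ennreal (a i) * emeasure (Q i) (B n))
          = ennreal (a i) * emeasure (Q i) (\<Union>n. B n)"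
        using B(2) by (simp add: suminf_emeasure)
    qed simp
    finally show "(\<Sum>n. \<Sum>i\<in>I. ennreal (a i) * emeasure (Q i) (B n))
        = (\<Sum>i\<in>I. ennreal (a i) * emeasure (Q i) (\<Union>n. B n))" .
  qed
qed

(* The data are a family w indexed by I, so repeated data points count with multiplicity. *)
definition empirical ::
  "'a::topological_space set \<Rightarrow> ('i \<Rightarrow> 'a) \<Rightarrow> 'i set \<Rightarrow> 'a measure" where
  "empirical \<Xi> w I =
     weighted_sum (borel_on \<Xi>) I (\<lambda>_. 1 / real (card I)) (\<lambda>l. return (borel_on \<Xi>) (w l))"

(* C k is the set of indices l of the data points w l in the k-th cluster. *)
definition ambiguity_set ::
  "'a::real_normed_vector set \<Rightarrow> ('a \<Rightarrow> real) \<Rightarrow> nat \<Rightarrow> (nat \<Rightarrow> 'a) \<Rightarrow>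
     nat \<Rightarrow> (nat \<Rightarrow> nat set) \<Rightarrow> (nat \<Rightarrow> real) \<Rightarrow> 'a measure set" where
  "ambiguity_set \<Xi> nrm N w K C \<theta> =
     {weighted_sum (borel_on \<Xi>) {1..K} (\<lambda>k. real (card (C k)) / real N) Q | Q.
        \<forall>k\<in>{1..K}. Q k \<in> wasserstein_ball \<Xi> nrm (\<theta> k) (empirical \<Xi> w (C k))}"

end

theory Submission
  imports Defs
begin

text \<open>The second inclusion is convexity of the Wasserstein distance: a weighted sum of couplings
  is a coupling of the weighted sums. For the first, a coupling of \<open>Q\<close> with the empirical measure
  is a family of densities \<open>f l\<close> with respect to \<open>Q\<close>, where \<open>f l x\<close> is the fraction of the mass
  at \<open>x\<close> sent to the data point \<open>w l\<close>. Collecting the data points of cluster \<open>k\<close> splits \<open>Q\<close> into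
  the measures \<open>Q k\<close> sought, and the transport cost from \<open>Q k\<close> is at most the total cost divided
  by the weight of the cluster. As the split depends on the coupling, near-optimal couplings do
  not suffice and the infimum has to be attained: minimizing sequences of densities can be chosen
  Cauchy in \<open>L\<^sup>2\<close>, so that an almost everywhere limit along a subsequence exists and Fatou's
  lemma applies.\<close>

section \<open>Integration against weighted sums and empirical measures\<close>

text \<open>Induction on the integrand: only the indicator case looks inside
  \<open>weighted_sum\<close>. In the monotone limit, supremum and sum may be exchanged because
  every summand increases with \<open>n\<close>.\<close>

lemma nn_integral_weighted_sum:
  assumes sets: "\<And>i. i \<in> I \<Longrightarrow> sets (Q i) = sets M"
    and f: "f \<in> borel_measurable M"
  shows "(\<integral>\<^sup>+x. f x \<partial>weighted_sum M I a Q) = (\<Sum>i\<in>I. ennreal (a i) * (\<integral>\<^sup>+x. f x \<partial>Q i))"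
  using f
proof (induction rule: borel_measurable_induct)
  case (cong f g)
  have "(\<integral>\<^sup>+x. f x \<partial>Q i) = (\<integral>\<^sup>+x. g x \<partial>Q i)" if "i \<in> I" for i
    using cong(3) sets_eq_imp_space_eq[OF sets[OF that]] by (intro nn_integral_cong) auto
  moreover have "(\<integral>\<^sup>+x. f x \<partial>weighted_sum M I a Q) = (\<integral>\<^sup>+x. g x \<partial>weighted_sum M I a Q)"
    using cong(3) by (intro nn_integral_cong) auto
  ultimately show ?case using cong(4) by (simp cong: sum.cong)
next
  case (set A)
  then have "A \<in> sets (Q i)" if "i \<in> I" for i using sets[OF that] by simp
  with set show ?case
    by (simp add: emeasure_weighted_sum[OF sets] cong: sum.cong)
next
  case (mult u c)
  have u: "u \<in> borel_measurable (Q i)" if "i \<in> I" for i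
    using mult(2) sets[OF that] by (simp cong: measurable_cong_sets)
  have u': "u \<in> borel_measurable (weighted_sum M I a Q)"
    using mult(2) by (simp cong: measurable_cong_sets)
  show ?case
    using u u' mult(4) by (simp add: nn_integral_cmult sum_distrib_left mult_ac cong: sum.cong)
next
  case (add u v)
  have m: "u \<in> borel_measurable (Q i)" "v \<in> borel_measurable (Q i)" if "i \<in> I" for i
    using add sets[OF that] by (simp_all cong: measurable_cong_sets)
  have m': "u \<in> borel_measurable (weighted_sum M I a Q)" "v \<in> borel_measurable (weighted_sum M I a Q)"
    using add by (simp_all cong: measurable_cong_sets)
  show ?case
    using m m' add by (simp add: nn_integral_add sum.distrib distrib_left cong: sum.cong)
next
  case (seq U)
  have m: "U n \<in> borel_measurable (Q i)" if "i \<in> I" for i n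
    using seq(1) sets[OF that] by (simp cong: measurable_cong_sets)
  have m': "U n \<in> borel_measurable (weighted_sum M I a Q)" for n
    using seq(1) by (simp cong: measurable_cong_sets)
  have inc: "incseq (\<lambda>n. ennreal (a i) * (\<integral>\<^sup>+x. U n x \<partial>Q i))" for i
    using seq(3) by (auto simp: incseq_def le_fun_def intro!: mult_left_mono nn_integral_mono)
  have "(\<integral>\<^sup>+x. (SUP n. U n) x \<partial>weighted_sum M I a Q) = (SUP n. \<integral>\<^sup>+x. U n x \<partial>weighted_sum M I a Q)"
    using nn_integral_monotone_convergence_SUP[OF seq(3) m'] by (simp add: image_comp)
  also have "\<dots> = (SUP n. \<Sum>i\<in>I. ennreal (a i) * (\<integral>\<^sup>+x. U n x \<partial>Q i))"
    using seq by simp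
  also have "\<dots> = (\<Sum>i\<in>I. SUP n. ennreal (a i) * (\<integral>\<^sup>+x. U n x \<partial>Q i))"
    by (intro ennreal_SUP_sum inc)
  also have "\<dots> = (\<Sum>i\<in>I. ennreal (a i) * (\<integral>\<^sup>+x. (SUP n. U n) x \<partial>Q i))"
    using nn_integral_monotone_convergence_SUP[OF seq(3) m]
    by (intro sum.cong) (simp_all add: SUP_mult_left_ennreal image_comp)
  finally show ?case .
qed

lemma prob_space_weighted_sum:
  assumes sets: "\<And>i. i \<in> I \<Longrightarrow> sets (Q i) = sets M"
    and "\<And>i. i \<in> I \<Longrightarrow> prob_space (Q i)"
    and "\<And>i. i \<in> I \<Longrightarrow> 0 \<le> a i" and "(\<Sum>i\<in>I. a i) = 1"
  shows "prob_space (weighted_sum M I a Q)"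
proof
  have "emeasure (Q i) (space M) = 1" if "i \<in> I" for i
    using assms(2)[OF that] sets_eq_imp_space_eq[OF sets[OF that]]
    by (metis prob_space.emeasure_space_1)
  then have "emeasure (weighted_sum M I a Q) (space M) = (\<Sum>i\<in>I. ennreal (a i))"
    by (simp add: emeasure_weighted_sum[OF sets])
  also have "\<dots> = 1" using assms by (simp add: sum_ennreal)
  finally show "emeasure (weighted_sum M I a Q) (space (weighted_sum M I a Q)) = 1" by simp
qed

lemma sets_empirical [simp]: "sets (empirical \<Xi> w I) = sets (borel_on \<Xi>)"
  and space_empirical [simp]: "space (empirical \<Xi> w I) = \<Xi>"
  by (simp_all add: empirical_def space_restrict_space)

lemma emeasure_empirical:
  assumes "finite I" "A \<in> sets (borel_on \<Xi>)"
  shows "emeasure (empirical \<Xi> w I) A = ennreal (real (card {l\<in>I. w l \<in> A}) / real (card I))"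
proof -
  have "emeasure (empirical \<Xi> w I) A = (\<Sum>l\<in>I. ennreal (1 / real (card I)) * indicator A (w l))"
    using assms by (simp add: empirical_def emeasure_weighted_sum)
  also have "\<dots> = (\<Sum>l\<in>I. ennreal (if w l \<in> A then 1 / real (card I) else 0))"
    by (intro sum.cong) (auto simp: indicator_def)
  also have "\<dots> = ennreal (\<Sum>l\<in>I. if w l \<in> A then 1 / real (card I) else 0)"
    by (simp add: sum_ennreal)
  also have "(\<Sum>l\<in>I. if w l \<in> A then 1 / real (card I) else 0) = real (card {l\<in>I. w l \<in> A}) / real (card I)"
    using assms(1) by (simp add: sum.If_cases Int_def conj_commute)
  finally show ?thesis .
qed

section \<open>Measurability of the transport cost\<close>

text \<open>\<open>nrm\<close> is unrelated to the norm of the type class, so its continuity needs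
  an argument: a norm is convex, and a real convex function on a finite-dimensional space is
  continuous.\<close>

lemma is_norm_continuous:
  fixes nrm :: "'a::euclidean_space \<Rightarrow> real"
  assumes "is_norm nrm"
  shows "continuous_on UNIV nrm"
proof (rule convex_on_continuous)
  show "convex_on UNIV nrm"
    using assms unfolding is_norm_def by (intro convex_onI) (auto, metis abs_of_nonneg abs_of_pos diff_ge_0_iff_ge less_imp_le)
qed simp

lemma borel_measurable_cost:
  fixes nrm :: "'a::euclidean_space \<Rightarrow> real"
  assumes "is_norm nrm"
  shows "(\<lambda>z. nrm (fst z - snd z)) \<in> borel_measurable (borel_on \<Xi> \<Otimes>\<^sub>M borel_on \<Xi>)"
proof -
  have nrm [measurable]: "nrm \<in> borel_measurable borel"
    using is_norm_continuous[OF assms] by (rule borel_measurable_continuous_onI)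
  have id: "(\<lambda>x. x) \<in> borel_measurable (borel_on \<Xi>)"
    by (simp add: measurable_restrict_space1)
  note [measurable] = measurable_compose[OF measurable_fst id] measurable_compose[OF measurable_snd id]
  show ?thesis by measurable
qed


section \<open>Semidiscrete transport plans and their cost\<close>

text \<open>\<open>f l x\<close> is the conditional probability of moving from \<open>x\<close> to
  data point \<open>l\<close>; the integral condition says that each data point receives mass
  \<open>1 / card I\<close>. Nonnegativity and total 1 are demanded at every point, not almost
  everywhere, so that \<open>0 \<le> f l x \<le> 1\<close> can be used without exceptional
  sets.\<close>

definition semidiscrete_plan :: "'a measure \<Rightarrow> 'i set \<Rightarrow> ('i \<Rightarrow> 'a \<Rightarrow> real) \<Rightarrow> bool" where
  "semidiscrete_plan Q I f \<longleftrightarrow>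
     (\<forall>l\<in>I. f l \<in> borel_measurable Q \<and> (\<integral>x. f l x \<partial>Q) = 1 / real (card I) \<and> (\<forall>x. 0 \<le> f l x)) \<and>
     (\<forall>x. (\<Sum>l\<in>I. f l x) = 1)"

definition plan_cost ::
    "'a measure \<Rightarrow> 'i set \<Rightarrow> ('i \<Rightarrow> 'a \<Rightarrow> real) \<Rightarrow> ('i \<Rightarrow> 'a \<Rightarrow> real) \<Rightarrow> ennreal" where
  "plan_cost Q I c f = (\<Sum>l\<in>I. \<integral>\<^sup>+x. ennreal (f l x * c l x) \<partial>Q)"

lemma semidiscrete_planD:
  assumes "semidiscrete_plan Q I f" "l \<in> I"
  shows "f l \<in> borel_measurable Q" "0 \<le> f l x" "(\<integral>x. f l x \<partial>Q) = 1 / real (card I)"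
    "(\<Sum>l\<in>I. f l x) = 1"
  using assms by (auto simp: semidiscrete_plan_def)

text \<open>A sum over an infinite index set is 0 by convention, which contradicts the total
  1.\<close>

lemma semidiscrete_plan_finite: "semidiscrete_plan Q I f \<Longrightarrow> finite I"
  unfolding semidiscrete_plan_def by (metis sum.infinite zero_neq_one)

lemma semidiscrete_plan_le_1:
  assumes "semidiscrete_plan Q I f" "l \<in> I"
  shows "f l x \<le> 1"
proof -
  have "f l x \<le> (\<Sum>l\<in>I. f l x)"
    using semidiscrete_planD(2)[OF assms(1)] assms(2) semidiscrete_plan_finite[OF assms(1)]
    by (intro member_le_sum) auto
  then show ?thesis using semidiscrete_planD(4)[OF assms] by simp
qed

lemma plan_cost_mono:
  assumes "finite I" "J \<subseteq> I"
  shows "plan_cost Q J c f \<le> plan_cost Q I c f"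
  unfolding plan_cost_def using assms by (intro sum_mono2) auto

section \<open>Existence of an optimal plan by the direct method\<close>

context prob_space
begin

lemma semidiscrete_plan_integrable:
  assumes "semidiscrete_plan M I f" "l \<in> I"
  shows "integrable M (f l)"
  using semidiscrete_planD[OF assms] semidiscrete_plan_le_1[OF assms]
  by (intro integrable_const_bound[where B=1]) auto

lemma semidiscrete_plan_integrable_mult:
  assumes "semidiscrete_plan M I f" "semidiscrete_plan M I g" "l \<in> I"
  shows "integrable M (\<lambda>x. f l x * g l x)"
proof (rule integrable_const_bound[where B=1])
  show "AE x in M. norm (f l x * g l x) \<le> 1"
    using semidiscrete_planD(2)[OF assms(1,3)] semidiscrete_planD(2)[OF assms(2,3)]
      semidiscrete_plan_le_1[OF assms(1,3)] semidiscrete_plan_le_1[OF assms(2,3)]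
    by (simp add: abs_mult mult_le_one)
  show "(\<lambda>x. f l x * g l x) \<in> borel_measurable M"
    using semidiscrete_planD(1)[OF assms(1,3)] semidiscrete_planD(1)[OF assms(2,3)] by simp
qed

lemma semidiscrete_plan_midpoint:
  assumes f: "semidiscrete_plan M I f" and g: "semidiscrete_plan M I g"
  shows "semidiscrete_plan M I (\<lambda>l x. (f l x + g l x) / 2)"
  unfolding semidiscrete_plan_def
proof (intro conjI ballI allI)
  fix l x assume l: "l \<in> I"
  note [measurable] = semidiscrete_planD(1)[OF f l] semidiscrete_planD(1)[OF g l]
  show "(\<lambda>x. (f l x + g l x) / 2) \<in> borel_measurable M" by measurable
  show "(\<integral>x. (f l x + g l x) / 2 \<partial>M) = 1 / real (card I)"
    using semidiscrete_plan_integrable[OF f l] semidiscrete_plan_integrable[OF g l]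
      semidiscrete_planD(3)[OF f l] semidiscrete_planD(3)[OF g l] by simp
  show "0 \<le> (f l x + g l x) / 2"
    using semidiscrete_planD(2)[OF f l] semidiscrete_planD(2)[OF g l] by simp
next
  fix x
  show "(\<Sum>l\<in>I. (f l x + g l x) / 2) = 1"
    using f g by (simp add: semidiscrete_plan_def sum.distrib flip: sum_divide_distrib)
qed

text \<open>The cost is affine in the plan. Together with \<open>semidiscrete_plan_midpoint\<close>
  this keeps midpoints inside a sublevel set of the cost, as the parallelogram argument below
  requires.\<close>

lemma plan_cost_midpoint_le:
  assumes f: "semidiscrete_plan M I f" and g: "semidiscrete_plan M I g"
    and c: "\<And>l. l \<in> I \<Longrightarrow> c l \<in> borel_measurable M" "\<And>l x. l \<in> I \<Longrightarrow> 0 \<le> c l x"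
    and "plan_cost M I c f \<le> t" "plan_cost M I c g \<le> t"
  shows "plan_cost M I c (\<lambda>l x. (f l x + g l x) / 2) \<le> t"
proof -
  have "(\<integral>\<^sup>+x. ennreal ((f l x + g l x) / 2 * c l x) \<partial>M)
      = ennreal (1/2) * (\<integral>\<^sup>+x. ennreal (f l x * c l x) \<partial>M) + ennreal (1/2) * (\<integral>\<^sup>+x. ennreal (g l x * c l x) \<partial>M)"
    if l: "l \<in> I" for l
  proof -
    note [measurable] = semidiscrete_planD(1)[OF f l] semidiscrete_planD(1)[OF g l] c(1)[OF l]
    have "ennreal ((f l x + g l x) / 2 * c l x)
      = ennreal (1/2) * ennreal (f l x * c l x) + ennreal (1/2) * ennreal (g l x * c l x)" for x
      using semidiscrete_planD(2)[OF f l, of x] semidiscrete_planD(2)[OF g l, of x] c(2)[OF l, of x]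
      by (simp add: field_simps del: ennreal_half flip: ennreal_plus ennreal_mult)
    then show ?thesis by (simp add: nn_integral_add nn_integral_cmult)
  qed
  then have "plan_cost M I c (\<lambda>l x. (f l x + g l x) / 2)
      = ennreal (1/2) * plan_cost M I c f + ennreal (1/2) * plan_cost M I c g"
    by (simp add: plan_cost_def sum.distrib sum_distrib_left)
  also have "\<dots> \<le> ennreal (1/2) * t + ennreal (1/2) * t"
    using assms by (intro add_mono mult_left_mono) auto
  also have "\<dots> = (ennreal (1/2) + ennreal (1/2)) * t" by (simp only: distrib_right)
  also have "ennreal (1/2) + ennreal (1/2) = 1" by (simp del: ennreal_half flip: ennreal_plus)
  finally show ?thesis by simp
qed

text \<open>Near-minimizers of the \<open>L\<^sup>2\<close> norm among the near-optimal plans are Cauchy by the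
  parallelogram identity, since midpoints of plans stay admissible.\<close>
lemma near_optimal_plans_L2_Cauchy:
  assumes c: "\<And>l. l \<in> I \<Longrightarrow> c l \<in> borel_measurable M" "\<And>l x. l \<in> I \<Longrightarrow> 0 \<le> c l x"
    and near: "\<And>e. 0 < e \<Longrightarrow> \<exists>f. semidiscrete_plan M I f \<and> plan_cost M I c f \<le> ennreal (t + e)"
  obtains F where "\<And>n::nat. semidiscrete_plan M I (F n)"
    and "\<And>n. plan_cost M I c (F n) \<le> ennreal (t + 1 / real (Suc n))"
    and "\<And>e. 0 < e \<Longrightarrow> \<exists>s. \<forall>m\<ge>s. \<forall>n\<ge>s. (\<Sum>l\<in>I. \<integral>x. (F m l x - F n l x)\<^sup>2 \<partial>M) < e"
proof -
  \<comment> \<open>\<open>S n\<close> are the plans within \<open>1 / Suc n\<close> of the target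
    cost, \<open>E\<close> is the squared L2 norm, and \<open>d n\<close> is its infimum over
    \<open>S n\<close>. As \<open>S n\<close> shrinks, \<open>d n\<close> increases; being bounded
    by \<open>card I\<close>, it converges.\<close>
  define S where "S n = {f. semidiscrete_plan M I f \<and> plan_cost M I c f \<le> ennreal (t + 1 / real (Suc n))}" for n :: nat
  define E where "E f = (\<Sum>l\<in>I. \<integral>x. (f l x)\<^sup>2 \<partial>M)" for f :: "'b \<Rightarrow> 'a \<Rightarrow> real"
  define d where "d n = Inf (E ` S n)" for n
  have plan: "semidiscrete_plan M I f" if "f \<in> S n" for f n
    using that by (simp add: S_def)
  have S_ne: "S n \<noteq> {}" for n
    using near[of "1 / real (Suc n)"] by (auto simp: S_def)
  have S_mono: "S n \<subseteq> S m" if "m \<le> n" for m n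
  proof -
    have "ennreal (t + 1 / real (Suc n)) \<le> ennreal (t + 1 / real (Suc m))"
      using that by (intro ennreal_leI) (simp add: frac_le)
    then show ?thesis by (auto simp: S_def)
  qed
  have E_nonneg: "0 \<le> E f" for f
    by (auto simp: E_def intro!: sum_nonneg)
  have bdd: "bdd_below (E ` S n)" for n
    using E_nonneg by (auto intro!: bdd_belowI)
  have E_le: "E f \<le> real (card I)" if "f \<in> S n" for f n
  proof -
    have "(\<integral>x. (f l x)\<^sup>2 \<partial>M) \<le> (\<integral>x. 1 \<partial>M)" if "l \<in> I" for l
    proof (rule integral_mono)
      show "integrable M (\<lambda>x. (f l x)\<^sup>2)"
        using semidiscrete_plan_integrable_mult[OF plan plan, OF \<open>f \<in> S n\<close> \<open>f \<in> S n\<close> \<open>l \<in> I\<close>]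
        by (simp add: power2_eq_square)
      show "(f l x)\<^sup>2 \<le> 1" for x
        using semidiscrete_planD(2)[OF plan, OF \<open>f \<in> S n\<close> \<open>l \<in> I\<close>]
          semidiscrete_plan_le_1[OF plan, OF \<open>f \<in> S n\<close> \<open>l \<in> I\<close>] by (simp add: power_le_one)
    qed simp
    then show ?thesis
      unfolding E_def using sum_bounded_above[of I "\<lambda>l. \<integral>x. (f l x)\<^sup>2 \<partial>M" 1] by (simp add: prob_space)
  qed
  have d_le: "d n \<le> E f" if "f \<in> S n" for f n
    unfolding d_def using bdd that by (intro cInf_lower) auto
  have d_mono: "d m \<le> d n" if "m \<le> n" for m n
    unfolding d_def using S_ne S_mono[OF that] bdd by (intro cInf_superset_mono) auto
  have "\<exists>f\<in>S n. E f < d n + 1 / real (Suc n)" for n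
    using cInf_lessD[of "E ` S n" "d n + 1 / real (Suc n)"] S_ne by (auto simp: d_def)
  then obtain F where F: "\<And>n. F n \<in> S n" and EF: "\<And>n. E (F n) < d n + 1 / real (Suc n)"
    by metis
  have "incseq d" using d_mono by (simp add: incseq_def)
  moreover have "d n \<le> real (card I)" for n
    using d_le[OF F] E_le[OF F] by (rule order_trans)
  ultimately obtain D where "d \<longlonglongrightarrow> D" by (metis incseq_convergent)
  then have Cauchy_d: "Cauchy d" by (rule LIMSEQ_imp_Cauchy)
  \<comment> \<open>The parallelogram identity, written with the midpoint instead of the
    sum.\<close>
  have par: "(\<Sum>l\<in>I. \<integral>x. (f l x - g l x)\<^sup>2 \<partial>M) = 2 * E f + 2 * E g - 4 * E (\<lambda>l x. (f l x + g l x) / 2)"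
    if f: "semidiscrete_plan M I f" and g: "semidiscrete_plan M I g" for f g
  proof -
    have "(\<integral>x. (f l x - g l x)\<^sup>2 \<partial>M)
        = 2 * (\<integral>x. (f l x)\<^sup>2 \<partial>M) + 2 * (\<integral>x. (g l x)\<^sup>2 \<partial>M) - 4 * (\<integral>x. ((f l x + g l x) / 2)\<^sup>2 \<partial>M)"
      if "l \<in> I" for l
    proof -
      have i: "integrable M (\<lambda>x. (f l x)\<^sup>2)" "integrable M (\<lambda>x. (g l x)\<^sup>2)"
        "integrable M (\<lambda>x. ((f l x + g l x) / 2)\<^sup>2)"
        using semidiscrete_plan_integrable_mult[OF f f that] semidiscrete_plan_integrable_mult[OF g g that]
          semidiscrete_plan_integrable_mult[OF semidiscrete_plan_midpoint[OF f g] semidiscrete_plan_midpoint[OF f g] that]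
        by (simp_all add: power2_eq_square)
      have "(\<integral>x. (f l x - g l x)\<^sup>2 \<partial>M)
          = (\<integral>x. (2 * (f l x)\<^sup>2 + 2 * (g l x)\<^sup>2) - 4 * ((f l x + g l x) / 2)\<^sup>2 \<partial>M)"
        by (intro Bochner_Integration.integral_cong) (simp_all add: power2_eq_square field_simps)
      also have "\<dots> = 2 * (\<integral>x. (f l x)\<^sup>2 \<partial>M) + 2 * (\<integral>x. (g l x)\<^sup>2 \<partial>M) - 4 * (\<integral>x. ((f l x + g l x) / 2)\<^sup>2 \<partial>M)"
        using i by (simp only: Bochner_Integration.integral_diff Bochner_Integration.integral_add integrable_mult_right
            Bochner_Integration.integrable_add Bochner_Integration.integrable_diff integral_mult_right_zero)
      finally show ?thesis .
    qed
    then show ?thesis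
      by (simp add: E_def sum.distrib sum_subtractf sum_distrib_left)
  qed
  \<comment> \<open>For \<open>m \<le> n\<close> both plans lie in \<open>S m\<close>, hence so does
    their midpoint, and its \<open>E\<close> is at least \<open>d m\<close>. Inserting this and the
    near-minimality of \<open>F m\<close> and \<open>F n\<close> into \<open>par\<close> gives the
    bound.\<close>
  have dist: "(\<Sum>l\<in>I. \<integral>x. (F m l x - F n l x)\<^sup>2 \<partial>M) \<le> 2 * (d n - d m) + 4 / real (Suc m)" if "m \<le> n" for m n
  proof -
    have "F n \<in> S m" using F S_mono[OF that] by auto
    then have "(\<lambda>l x. (F m l x + F n l x) / 2) \<in> S m"
      using F[of m] semidiscrete_plan_midpoint plan_cost_midpoint_le[OF _ _ c] by (auto simp: S_def)
    from d_le[OF this] par[OF plan[OF F[of m]] plan[OF F[of n]]] EF[of m] EF[of n]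
    have "(\<Sum>l\<in>I. \<integral>x. (F m l x - F n l x)\<^sup>2 \<partial>M) \<le> 2 * (d n - d m) + 2 / real (Suc m) + 2 / real (Suc n)"
      by simp
    moreover have "2 / real (Suc n) \<le> 2 / real (Suc m)" using that by (simp add: frac_le)
    ultimately show ?thesis by simp
  qed
  show ?thesis
  proof (rule that[of F])
    show "semidiscrete_plan M I (F n)" "plan_cost M I c (F n) \<le> ennreal (t + 1 / real (Suc n))" for n
      using F[of n] by (simp_all add: S_def)
    fix e :: real assume e: "0 < e"
    \<comment> \<open>The tolerance is split to fit \<open>dist\<close>: twice \<open>e / 4\<close>
      for the increment of \<open>d\<close>, and four times \<open>e / 8\<close> for the error
      term.\<close>
    obtain s1 where s1: "\<forall>m\<ge>s1. \<forall>n\<ge>s1. norm (d m - d n) < e / 4"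
      using CauchyD[OF Cauchy_d, of "e/4"] e by auto
    obtain s2 where s2: "1 / real (Suc s2) < e / 8"
      using e by (metis nat_approx_posE divide_pos_pos zero_less_numeral)
    have *: "(\<Sum>l\<in>I. \<integral>x. (F m l x - F n l x)\<^sup>2 \<partial>M) < e" if "max s1 s2 \<le> m" "m \<le> n" for m n
    proof -
      have "1 / real (Suc m) \<le> 1 / real (Suc s2)" using that by (simp add: frac_le)
      then have "4 / real (Suc m) < e / 2" using s2 by simp
      moreover have "d n - d m < e / 4" using s1[rule_format, of m n] that unfolding real_norm_def abs_less_iff by linarith
      ultimately show ?thesis using dist[OF \<open>m \<le> n\<close>] by simp
    qed
    have "(\<Sum>l\<in>I. \<integral>x. (F m l x - F n l x)\<^sup>2 \<partial>M) < e" if "max s1 s2 \<le> m" "max s1 s2 \<le> n" for m n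
      using *[of m n] *[of n m] that by (cases "m \<le> n") (auto simp: power2_commute)
    then show "\<exists>s. \<forall>m\<ge>s. \<forall>n\<ge>s. (\<Sum>l\<in>I. \<integral>x. (F m l x - F n l x)\<^sup>2 \<partial>M) < e" by blast
  qed
qed

text \<open>The L2 bounds on the increments become summable L1 bounds. Hence the sum of the absolute
  increments has finite integral and is finite almost everywhere, and at such points the telescoping
  series converges.\<close>

lemma fast_L2_Cauchy_AE_convergent:
  fixes g :: "nat \<Rightarrow> 'a \<Rightarrow> real"
  assumes [measurable]: "\<And>n. g n \<in> borel_measurable M"
    and sq: "\<And>n. integrable M (\<lambda>x. (g (Suc n) x - g n x)\<^sup>2)"
    and fast: "\<And>n. (\<integral>x. (g (Suc n) x - g n x)\<^sup>2 \<partial>M) \<le> (1/4)^n"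
  shows "AE x in M. convergent (\<lambda>n. g n x)"
proof -
  have le: "(\<integral>\<^sup>+x. ennreal \<bar>g (Suc n) x - g n x\<bar> \<partial>M) \<le> ennreal (2 * (1/2)^n)" for n
  proof -
    \<comment> \<open>Young's inequality with weight \<open>2^n\<close>, chosen so that after
      integration both terms are at most \<open>(1/2)^n\<close>, because
      \<open>2^n * (1/4)^n = (1/2)^n\<close>.\<close>
    have "ennreal \<bar>g (Suc n) x - g n x\<bar> \<le> ennreal ((1/2)^n + 2^n * (g (Suc n) x - g n x)\<^sup>2)" for x
    proof (rule ennreal_leI)
      define u where "u = \<bar>g (Suc n) x - g n x\<bar>"
      have "0 \<le> (2^n * u - 1)\<^sup>2" by simp
      then have "2 * (2^n * u) \<le> (2^n * u)\<^sup>2 + 1" by (simp add: power2_diff)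
      moreover have "0 \<le> 2^n * u" by (simp add: u_def)
      ultimately have "2^n * u \<le> 1 + (2^n * u)\<^sup>2" by linarith
      then have "(1/2)^n * (2^n * u) \<le> (1/2)^n * (1 + (2^n * u)\<^sup>2)"
        by (intro mult_left_mono) auto
      then have "u \<le> (1/2)^n + 2^n * u\<^sup>2"
        by (simp add: field_simps power2_eq_square)
      then show "\<bar>g (Suc n) x - g n x\<bar> \<le> (1/2)^n + 2^n * (g (Suc n) x - g n x)\<^sup>2"
        by (simp add: u_def)
    qed
    then have "(\<integral>\<^sup>+x. ennreal \<bar>g (Suc n) x - g n x\<bar> \<partial>M)
        \<le> (\<integral>\<^sup>+x. ennreal ((1/2)^n + 2^n * (g (Suc n) x - g n x)\<^sup>2) \<partial>M)"
      by (intro nn_integral_mono)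
    also have "\<dots> = ennreal (\<integral>x. (1/2)^n + 2^n * (g (Suc n) x - g n x)\<^sup>2 \<partial>M)"
      using sq by (intro nn_integral_eq_integral) (auto intro!: AE_I2)
    also have "(\<integral>x. (1/2)^n + 2^n * (g (Suc n) x - g n x)\<^sup>2 \<partial>M)
        = (1/2)^n + 2^n * (\<integral>x. (g (Suc n) x - g n x)\<^sup>2 \<partial>M)"
      using sq[of n] by (simp add: prob_space)
    also have "ennreal \<dots> \<le> ennreal (2 * (1/2)^n)"
    proof (rule ennreal_leI)
      have "2^n * (\<integral>x. (g (Suc n) x - g n x)\<^sup>2 \<partial>M) \<le> 2^n * (1/4)^n"
        using fast by (intro mult_left_mono) auto
      also have "\<dots> = (1/2::real)^n" by (simp flip: power_mult_distrib)
      finally show "(1/2)^n + 2^n * (\<integral>x. (g (Suc n) x - g n x)\<^sup>2 \<partial>M) \<le> 2 * (1/2)^n" by simp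
    qed
    finally show ?thesis .
  qed
  have "(\<integral>\<^sup>+x. (\<Sum>n. ennreal \<bar>g (Suc n) x - g n x\<bar>) \<partial>M) = (\<Sum>n. \<integral>\<^sup>+x. ennreal \<bar>g (Suc n) x - g n x\<bar> \<partial>M)"
    by (intro nn_integral_suminf) measurable
  also have "\<dots> \<le> (\<Sum>n. ennreal (2 * (1/2)^n))"
    using le by (intro suminf_le) auto
  also have "\<dots> = ennreal (\<Sum>n. 2 * (1/2)^n)"
    by (intro suminf_ennreal2 summable_mult summable_geometric) auto
  also have "\<dots> < \<infinity>" by simp
  finally have "AE x in M. (\<Sum>n. ennreal \<bar>g (Suc n) x - g n x\<bar>) \<noteq> \<infinity>"
    by (intro nn_integral_PInf_AE) auto
  then show ?thesis
  proof eventually_elim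
    fix x assume "(\<Sum>n. ennreal \<bar>g (Suc n) x - g n x\<bar>) \<noteq> \<infinity>"
    then have "summable (\<lambda>n. \<bar>g (Suc n) x - g n x\<bar>)"
      by (intro summable_suminf_not_top) auto
    then have "summable (\<lambda>n. g (Suc n) x - g n x)" by (rule summable_rabs_cancel)
    then have "convergent (\<lambda>n. \<Sum>i<n. g (Suc i) x - g i x)" by (simp add: summable_iff_convergent)
    then have "convergent (\<lambda>n. g n x - g 0 x)" by (simp only: sum_lessThan_telescope[of "\<lambda>i. g i x"])
    then have "convergent (\<lambda>n. (g n x - g 0 x) + g 0 x)" by (rule convergent_add[OF _ convergent_const])
    then show "convergent (\<lambda>n. g n x)" by simp
  qed
qed

text \<open>A subsequence of the L2-Cauchy plans converges almost everywhere. The bound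
  \<open>f l x \<le> 1\<close> lets the prescribed masses pass to the limit by dominated
  convergence, and Fatou's lemma shows that the limit costs at most \<open>t\<close>.\<close>

lemma optimal_plan_exists:
  assumes c: "\<And>l. l \<in> I \<Longrightarrow> c l \<in> borel_measurable M" "\<And>l x. l \<in> I \<Longrightarrow> 0 \<le> c l x"
    and near: "\<And>e. 0 < e \<Longrightarrow> \<exists>f. semidiscrete_plan M I f \<and> plan_cost M I c f \<le> ennreal (t + e)"
  shows "\<exists>f. semidiscrete_plan M I f \<and> plan_cost M I c f \<le> ennreal t"
proof -
  obtain F where F: "\<And>n::nat. semidiscrete_plan M I (F n)"
    and costF: "\<And>n. plan_cost M I c (F n) \<le> ennreal (t + 1 / real (Suc n))"
    and Cauchy: "\<And>e. 0 < e \<Longrightarrow> \<exists>s. \<forall>m\<ge>s. \<forall>n\<ge>s. (\<Sum>l\<in>I. \<integral>x. (F m l x - F n l x)\<^sup>2 \<partial>M) < e"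
    using near_optimal_plans_L2_Cauchy[where I=I and c=c and t=t, OF c near] by blast
  have finI: "finite I" using semidiscrete_plan_finite[OF F] .
  have "\<forall>k::nat. \<exists>s. \<forall>m\<ge>s. \<forall>n\<ge>s. (\<Sum>l\<in>I. \<integral>x. (F m l x - F n l x)\<^sup>2 \<partial>M) < (1/4)^k"
    by (intro allI Cauchy) simp
  from choice[OF this] obtain s
    where s: "\<And>k m n. s k \<le> m \<Longrightarrow> s k \<le> n \<Longrightarrow> (\<Sum>l\<in>I. \<integral>x. (F m l x - F n l x)\<^sup>2 \<partial>M) < (1/4)^k"
    by blast
  \<comment> \<open>Summing the moduli \<open>s i\<close> makes both \<open>r k\<close> and
    \<open>r (Suc k)\<close> at least \<open>s k\<close>, so consecutive members of the subsequence
    are close at rate \<open>(1/4)^k\<close>. The summand \<open>k\<close> ensures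
    \<open>k \<le> r k\<close>, so the cost bounds survive the reindexing.\<close>
  define r where "r k = k + (\<Sum>i\<le>k. s i)" for k
  have r: "k \<le> r k" "s k \<le> r k" "s k \<le> r (Suc k)" for k
    unfolding r_def using member_le_sum[of k "{..k}" s] by (auto simp: atMost_Suc)
  define G where "G n = F (r n)" for n
  have G: "semidiscrete_plan M I (G n)" for n using F by (simp add: G_def)
  have [measurable]: "G n l \<in> borel_measurable M" if "l \<in> I" for n l
    using semidiscrete_planD(1)[OF G that] .
  have costG: "plan_cost M I c (G n) \<le> ennreal (t + 1 / real (Suc n))" for n
  proof -
    have "ennreal (t + 1 / real (Suc (r n))) \<le> ennreal (t + 1 / real (Suc n))"
      using r(1)[of n] by (intro ennreal_leI) (simp add: frac_le)
    then show ?thesis unfolding G_def using costF order_trans by blast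
  qed
  have "AE x in M. convergent (\<lambda>n. G n l x)" if l: "l \<in> I" for l
  proof (rule fast_L2_Cauchy_AE_convergent)
    have "(\<lambda>x. (G (Suc n) l x - G n l x)\<^sup>2)
        = (\<lambda>x. G (Suc n) l x * G (Suc n) l x + G n l x * G n l x - 2 * (G (Suc n) l x * G n l x))" for n
      by (simp add: power2_eq_square algebra_simps)
    then show "integrable M (\<lambda>x. (G (Suc n) l x - G n l x)\<^sup>2)" for n
      using semidiscrete_plan_integrable_mult[OF G G l] by simp
    have "(\<integral>x. (G (Suc n) l x - G n l x)\<^sup>2 \<partial>M) \<le> (\<Sum>l\<in>I. \<integral>x. (G (Suc n) l x - G n l x)\<^sup>2 \<partial>M)" for n
      using finI l by (intro member_le_sum[where f="\<lambda>l. \<integral>x. (G (Suc n) l x - G n l x)\<^sup>2 \<partial>M"]) auto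
    then show "(\<integral>x. (G (Suc n) l x - G n l x)\<^sup>2 \<partial>M) \<le> (1/4)^n" for n
      using s[OF r(3)[of n] r(2)[of n]] unfolding G_def by (meson less_imp_le order_trans)
  qed (use l in measurable)
  then have conv: "AE x in M. \<forall>l\<in>I. convergent (\<lambda>n. G n l x)"
    using finI by (simp add: AE_finite_all)
  \<comment> \<open>Where some component fails to converge, all components fall back on the plan
    \<open>G 0\<close>. Testing all of \<open>I\<close> at once keeps the components consistent, so
    they are nonnegative and sum to 1 at every point.\<close>
  define f where "f l x = (if \<forall>l\<in>I. convergent (\<lambda>n. G n l x) then lim (\<lambda>n. G n l x) else G 0 l x)" for l x
  have lim: "AE x in M. \<forall>l\<in>I. (\<lambda>n. G n l x) \<longlonglongrightarrow> f l x"
    using conv by eventually_elim (auto simp: f_def convergent_LIMSEQ_iff)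
  have fm [measurable]: "f l \<in> borel_measurable M" if l[measurable]: "l \<in> I" for l
  proof -
    \<comment> \<open>Convergence is replaced by the Cauchy property, which is a countable condition
      and therefore measurable.\<close>
    have "{x\<in>space M. \<forall>l\<in>I. convergent (\<lambda>n. G n l x)} \<in> sets M"
      using finI by (intro sets.sets_Collect_finite_All) (auto simp: Cauchy_convergent_iff[symmetric])
    then have [measurable]: "Measurable.pred M (\<lambda>x. \<forall>l\<in>I. convergent (\<lambda>n. G n l x))"
      by (simp add: pred_def)
    have [measurable]: "(\<lambda>x. lim (\<lambda>n. G n l x)) \<in> borel_measurable M"
      using l by (intro borel_measurable_lim_metric) auto
    have [measurable]: "G 0 l \<in> borel_measurable M" using l by simp
    show ?thesis unfolding f_def by measurable
  qed
  have sub: "0 \<le> f l x" "(\<Sum>l\<in>I. f l x) = 1" if "l \<in> I" for l x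
  proof -
    have "(\<forall>l\<in>I. 0 \<le> f l x) \<and> (\<Sum>l\<in>I. f l x) = 1"
    proof (cases "\<forall>l\<in>I. convergent (\<lambda>n. G n l x)")
      case True
      then have L: "(\<lambda>n. G n l x) \<longlonglongrightarrow> f l x" if "l \<in> I" for l
        using that by (auto simp: f_def convergent_LIMSEQ_iff)
      have "(\<lambda>n. \<Sum>l\<in>I. G n l x) \<longlonglongrightarrow> (\<Sum>l\<in>I. f l x)" by (intro tendsto_sum L)
      moreover have "(\<Sum>l\<in>I. G n l x) = 1" for n using G by (simp add: semidiscrete_plan_def)
      ultimately have "(\<Sum>l\<in>I. f l x) = 1" by (simp add: LIMSEQ_const_iff)
      moreover have "0 \<le> f l x" if "l \<in> I" for l
        using L[OF that] semidiscrete_planD(2)[OF G that] by (intro LIMSEQ_le_const) auto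
      ultimately show ?thesis by blast
    next
      case False
      then have "f l x = G 0 l x" for l unfolding f_def by (simp only: if_False)
      then show ?thesis using G[of 0] by (simp add: semidiscrete_plan_def)
    qed
    then show "0 \<le> f l x" "(\<Sum>l\<in>I. f l x) = 1" using that by auto
  qed
  have "semidiscrete_plan M I f"
    unfolding semidiscrete_plan_def
  proof (intro conjI ballI allI)
    fix l assume l: "l \<in> I"
    have "(\<lambda>n. \<integral>x. G n l x \<partial>M) \<longlonglongrightarrow> (\<integral>x. f l x \<partial>M)"
    proof (rule integral_dominated_convergence[where w="\<lambda>_. 1"])
      show "AE x in M. (\<lambda>n. G n l x) \<longlonglongrightarrow> f l x" using lim l by auto
      show "AE x in M. norm (G n l x) \<le> 1" for n
        using semidiscrete_planD(2)[OF G l] semidiscrete_plan_le_1[OF G l] by simp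
    qed (use l in auto)
    then show "(\<integral>x. f l x \<partial>M) = 1 / real (card I)"
      using semidiscrete_planD(3)[OF G l] by (simp add: LIMSEQ_const_iff)
  next
    fix x
    have "I \<noteq> {}" using G[of 0] by (auto simp: semidiscrete_plan_def)
    then show "(\<Sum>l\<in>I. f l x) = 1" using sub(2) by blast
  qed (use fm sub(1) in auto)
  moreover have "plan_cost M I c f \<le> ennreal t"
  proof -
    let ?H = "\<lambda>n x. \<Sum>l\<in>I. ennreal (G n l x * c l x)"
    have [measurable]: "c l \<in> borel_measurable M" if "l \<in> I" for l using c(1) that .
    have H: "plan_cost M I c g = (\<integral>\<^sup>+x. (\<Sum>l\<in>I. ennreal (g l x * c l x)) \<partial>M)"
      if "\<And>l. l \<in> I \<Longrightarrow> g l \<in> borel_measurable M" for g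
      unfolding plan_cost_def using that by (intro nn_integral_sum[symmetric]) simp
    have "plan_cost M I c f = (\<integral>\<^sup>+x. (\<Sum>l\<in>I. ennreal (f l x * c l x)) \<partial>M)" using fm by (rule H)
    also have "\<dots> = (\<integral>\<^sup>+x. liminf (\<lambda>n. ?H n x) \<partial>M)"
    proof (rule nn_integral_cong_AE)
      show "AE x in M. (\<Sum>l\<in>I. ennreal (f l x * c l x)) = liminf (\<lambda>n. ?H n x)"
        using lim
      proof eventually_elim
        fix x assume L: "\<forall>l\<in>I. (\<lambda>n. G n l x) \<longlonglongrightarrow> f l x"
        have "(\<lambda>n. ?H n x) \<longlonglongrightarrow> (\<Sum>l\<in>I. ennreal (f l x * c l x))"
          using L by (intro tendsto_sum tendsto_ennrealI tendsto_mult) auto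
        then show "(\<Sum>l\<in>I. ennreal (f l x * c l x)) = liminf (\<lambda>n. ?H n x)"
          by (intro lim_imp_Liminf[symmetric]) auto
      qed
    qed
    \<comment> \<open>Fatou's lemma.\<close>
    also have "\<dots> \<le> liminf (\<lambda>n. \<integral>\<^sup>+x. ?H n x \<partial>M)"
      by (intro nn_integral_liminf) auto
    also have "\<dots> = liminf (\<lambda>n. plan_cost M I c (G n))"
      by (simp add: H)
    also have "\<dots> \<le> liminf (\<lambda>n. ennreal (t + 1 / real (Suc n)))"
      using costG by (intro Liminf_mono) auto
    also have "\<dots> = ennreal t"
    proof (rule lim_imp_Liminf)
      have "(\<lambda>n. t + 1 / real (Suc n)) \<longlonglongrightarrow> t + 0"
        by (intro tendsto_add tendsto_const) (use LIMSEQ_inverse_real_of_nat in \<open>simp add: inverse_eq_divide\<close>)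
      then show "(\<lambda>n. ennreal (t + 1 / real (Suc n))) \<longlonglongrightarrow> ennreal t"
        by (intro tendsto_ennrealI) simp
    qed simp
    finally show ?thesis .
  qed
  ultimately show ?thesis by blast
qed

end


section \<open>Disintegration of a coupling over the atoms of an empirical measure\<close>

lemma singleton_in_borel_on:
  fixes \<Xi> :: "'a::t1_space set"
  assumes "y \<in> \<Xi>"
  shows "{y} \<in> sets (borel_on \<Xi>)"
proof -
  have "{y} = \<Xi> \<inter> {y}" using assms by auto
  then show ?thesis unfolding sets_restrict_space by (intro image_eqI[where x="{y}"]) auto
qed

text \<open>A coupling with an empirical measure is disintegrated into the densities of its slices
  over the atoms; a repeated data point shares its slice equally among its copies.\<close>
lemma coupling_imp_plan:
  fixes \<Xi> :: "'a::euclidean_space set" and h :: "'a \<times> 'a \<Rightarrow> real"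
  assumes I: "finite I" "I \<noteq> {}" and w: "\<And>l. l \<in> I \<Longrightarrow> w l \<in> \<Xi>"
    and Q: "Q \<in> prob_measures \<Xi>" and \<pi>: "\<pi> \<in> couplings \<Xi> Q (empirical \<Xi> w I)"
    and h: "h \<in> borel_measurable (borel_on \<Xi> \<Otimes>\<^sub>M borel_on \<Xi>)" "\<And>z. 0 \<le> h z"
  shows "\<exists>f. semidiscrete_plan Q I f \<and>
    plan_cost Q I (\<lambda>l x. h (x, w l)) f = (\<integral>\<^sup>+z. ennreal (h z) \<partial>\<pi>)"
proof -
  let ?M = "borel_on \<Xi>"
  interpret Q: prob_space Q using Q by (simp add: prob_measures_def)
  interpret \<pi>: prob_space \<pi> using \<pi> by (simp add: couplings_def)
  have sets_Q [measurable_cong]: "sets Q = sets ?M" using Q by (simp add: prob_measures_def)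
  have sets_\<pi> [measurable_cong]: "sets \<pi> = sets (?M \<Otimes>\<^sub>M ?M)" using \<pi> by (simp add: couplings_def)
  have fst_\<pi>: "distr \<pi> ?M fst = Q" and snd_\<pi>: "distr \<pi> ?M snd = empirical \<Xi> w I"
    using \<pi> by (simp_all add: couplings_def)
  have sing [measurable]: "{w l} \<in> sets ?M" if "l \<in> I" for l using w[OF that] by (rule singleton_in_borel_on)
  have space_M: "space ?M = \<Xi>" by (simp add: space_restrict_space)
  \<comment> \<open>The multiplicity of the data point \<open>w l\<close>.\<close>
  define n where "n l = card {j\<in>I. w j = w l}" for l
  have n_pos: "0 < n l" if "l \<in> I" for l using that I by (auto simp: n_def card_gt_0_iff)
  have atoms: "AE z in \<pi>. snd z \<in> w ` I"
  proof -
    have w_sets: "w ` I \<in> sets ?M"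
      using I(1) sing sets.finite_UN[of I "\<lambda>l. {w l}"] by (simp add: UNION_singleton_eq_range)
    then have c: "space ?M - w ` I \<in> sets ?M" by (intro sets.compl_sets)
    have "{l \<in> I. w l \<in> space ?M - w ` I} = {}" by auto
    then have "emeasure (empirical \<Xi> w I) (space ?M - w ` I) = 0"
      using emeasure_empirical[OF I(1) c, of w] by (simp only: card.empty) simp
    then have "AE y in empirical \<Xi> w I. y \<in> w ` I"
      using c by (intro AE_I[where N="space ?M - w ` I"]) (auto simp: space_M)
    then have "AE y in distr \<pi> ?M snd. y \<in> w ` I" by (simp only: snd_\<pi>)
    then show ?thesis
    proof (subst (asm) AE_distr_iff)
      have "{y \<in> space ?M. y \<in> w ` I} = w ` I" using w by (auto simp: space_M)
      then show "{y \<in> space ?M. y \<in> w ` I} \<in> sets ?M" using w_sets by simp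
    qed auto
  qed
  define slice where "slice l z = (indicator {w l} (snd z) :: ennreal)" for l and z :: "'a \<times> 'a"
  have slice [measurable]: "slice l \<in> borel_measurable \<pi>" if [measurable]: "l \<in> I" for l
    unfolding slice_def by measurable
  \<comment> \<open>\<open>\<nu> l\<close> sends \<open>A\<close> to the mass that
    \<open>\<pi>\<close> gives to \<open>A\<close> times \<open>{w l}\<close>. It is dominated by
    the first marginal \<open>Q\<close>, hence has a density \<open>g l\<close> with respect to
    \<open>Q\<close>.\<close>
  define \<nu> where "\<nu> l = distr (density \<pi> (slice l)) ?M fst" for l
  have \<nu>: "(\<integral>\<^sup>+x. u x \<partial>\<nu> l) = (\<integral>\<^sup>+z. slice l z * u (fst z) \<partial>\<pi>)"
    if [measurable]: "l \<in> I" "u \<in> borel_measurable ?M" for l u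
    unfolding \<nu>_def by (subst nn_integral_distr, measurable) (subst nn_integral_density, auto)
  have ac: "absolutely_continuous Q (\<nu> l)" if l: "l \<in> I" for l
    unfolding absolutely_continuous_def
  proof
    fix A assume "A \<in> null_sets Q"
    then have A [measurable]: "A \<in> sets ?M" and QA: "emeasure Q A = 0" by (auto simp: sets_Q)
    have "emeasure (\<nu> l) A = (\<integral>\<^sup>+x. indicator A x \<partial>\<nu> l)" using A by (simp add: \<nu>_def)
    also have "\<dots> = (\<integral>\<^sup>+z. slice l z * indicator A (fst z) \<partial>\<pi>)" using l by (intro \<nu>) auto
    also have "\<dots> \<le> (\<integral>\<^sup>+z. indicator A (fst z) \<partial>\<pi>)"
      by (intro nn_integral_mono) (auto simp: slice_def indicator_def)
    also have "\<dots> = (\<integral>\<^sup>+x. indicator A x \<partial>distr \<pi> ?M fst)" by (subst nn_integral_distr) auto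
    also have "\<dots> = 0" using A QA by (simp add: fst_\<pi> sets_Q)
    finally show "A \<in> null_sets (\<nu> l)" using A by (simp add: null_sets_def \<nu>_def)
  qed
  define g where "g l = RN_deriv Q (\<nu> l)" for l
  have g_meas [measurable]: "g l \<in> borel_measurable Q" for l by (simp add: g_def)
  have g: "(\<integral>\<^sup>+x. g l x * u x \<partial>Q) = (\<integral>\<^sup>+z. slice l z * u (fst z) \<partial>\<pi>)"
    if l: "l \<in> I" and u [measurable]: "u \<in> borel_measurable ?M" for l u
  proof -
    have "density Q (g l) = \<nu> l"
      unfolding g_def using ac[OF l] by (intro Q.density_RN_deriv) (simp_all add: \<nu>_def sets_Q)
    then have "(\<integral>\<^sup>+x. g l x * u x \<partial>Q) = (\<integral>\<^sup>+x. u x \<partial>\<nu> l)"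
      by (subst nn_integral_density[symmetric]) auto
    then show ?thesis using \<nu>[OF l u] by simp
  qed
  define f0 where "f0 l x = ennreal (1 / real (n l)) * g l x" for l x
  have f0_meas [measurable]: "f0 l \<in> borel_measurable Q" for l unfolding f0_def by measurable
  \<comment> \<open>The disintegration formula. It is applied twice: to indicators of
    \<open>A\<close> in the first coordinate, which yields total 1, and to \<open>h\<close>, which
    yields the cost.\<close>
  have f0: "(\<Sum>l\<in>I. \<integral>\<^sup>+x. f0 l x * H (x, w l) \<partial>Q) = (\<integral>\<^sup>+z. H z \<partial>\<pi>)"
    if H [measurable]: "H \<in> borel_measurable (?M \<Otimes>\<^sub>M ?M)" for H
  proof -
    have Hl [measurable]: "(\<lambda>x. H (x, w l)) \<in> borel_measurable ?M" if "l \<in> I" for l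
      using w[OF that] by (intro measurable_compose[OF _ H] measurable_Pair) (auto simp: space_M)
    have "(\<Sum>l\<in>I. \<integral>\<^sup>+x. f0 l x * H (x, w l) \<partial>Q)
        = (\<Sum>l\<in>I. ennreal (1 / real (n l)) * (\<integral>\<^sup>+x. g l x * H (x, w l) \<partial>Q))"
      unfolding f0_def by (intro sum.cong refl) (simp add: mult.assoc nn_integral_cmult)
    also have "\<dots> = (\<Sum>l\<in>I. ennreal (1 / real (n l)) * (\<integral>\<^sup>+z. slice l z * H (fst z, w l) \<partial>\<pi>))"
      using g[OF _ Hl] by (intro sum.cong refl) simp
    also have "\<dots> = (\<Sum>l\<in>I. \<integral>\<^sup>+z. ennreal (1 / real (n l)) * (slice l z * H (fst z, w l)) \<partial>\<pi>)"
    proof (intro sum.cong refl nn_integral_cmult[symmetric])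
      fix l assume [measurable]: "l \<in> I"
      have [measurable]: "(\<lambda>z. H (fst z, w l)) \<in> borel_measurable (?M \<Otimes>\<^sub>M ?M)"
        by (rule measurable_compose[OF measurable_fst Hl]) fact
      show "(\<lambda>z. slice l z * H (fst z, w l)) \<in> borel_measurable \<pi>" by measurable
    qed
    also have "\<dots> = (\<integral>\<^sup>+z. (\<Sum>l\<in>I. ennreal (1 / real (n l)) * (slice l z * H (fst z, w l))) \<partial>\<pi>)"
    proof (intro nn_integral_sum[symmetric])
      fix l assume [measurable]: "l \<in> I"
      have [measurable]: "(\<lambda>z. H (fst z, w l)) \<in> borel_measurable (?M \<Otimes>\<^sub>M ?M)"
        by (rule measurable_compose[OF measurable_fst Hl]) fact
      show "(\<lambda>z. ennreal (1 / real (n l)) * (slice l z * H (fst z, w l))) \<in> borel_measurable \<pi>" by measurable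
    qed
    also have "\<dots> = (\<integral>\<^sup>+z. H z \<partial>\<pi>)"
    proof (rule nn_integral_cong_AE)
      show "AE z in \<pi>. (\<Sum>l\<in>I. ennreal (1 / real (n l)) * (slice l z * H (fst z, w l))) = H z"
        using atoms
      proof eventually_elim
        fix z :: "'a \<times> 'a" assume "snd z \<in> w ` I"
        then obtain j where j: "j \<in> I" "snd z = w j" by auto
        then have H_z: "H (fst z, w j) = H z" by (metis surjective_pairing)
        \<comment> \<open>Exactly the \<open>n j\<close> copies of the point \<open>w j\<close>
          contribute, each with weight \<open>1 / n j\<close>.\<close>
        have "(\<Sum>l\<in>I. ennreal (1 / real (n l)) * (slice l z * H (fst z, w l)))
            = (\<Sum>l\<in>I. if w l = w j then ennreal (1 / real (n j)) * H z else 0)"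
          using j by (intro sum.cong) (auto simp: slice_def n_def H_z)
        also have "\<dots> = of_nat (n j) * (ennreal (1 / real (n j)) * H z)"
          using I(1) by (simp add: n_def sum.If_cases Int_def)
        also have "\<dots> = ennreal (real (n j) * (1 / real (n j))) * H z"
          unfolding mult.assoc[symmetric] ennreal_of_nat_eq_real_of_nat
          by (subst ennreal_mult[symmetric]) auto
        also have "\<dots> = H z" using n_pos[OF j(1)] by simp
        finally show "(\<Sum>l\<in>I. ennreal (1 / real (n l)) * (slice l z * H (fst z, w l))) = H z" .
      qed
    qed
    finally show ?thesis .
  qed
  \<comment> \<open>Both sides are densities of \<open>Q\<close> with respect to \<open>Q\<close>
    itself, and such densities are unique almost everywhere.\<close>
  have sum1: "AE x in Q. (\<Sum>l\<in>I. f0 l x) = 1"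
  proof (rule Q.density_unique_finite_measure)
    fix A assume "A \<in> sets Q"
    then have A [measurable]: "A \<in> sets ?M" by (simp add: sets_Q)
    have "(\<integral>\<^sup>+x. (\<Sum>l\<in>I. f0 l x) * indicator A x \<partial>Q) = (\<Sum>l\<in>I. \<integral>\<^sup>+x. f0 l x * indicator A x \<partial>Q)"
      by (subst nn_integral_sum[symmetric]) (simp_all add: sum_distrib_right)
    also have "\<dots> = (\<integral>\<^sup>+z. indicator A (fst z) \<partial>\<pi>)"
      using f0[of "\<lambda>z. indicator A (fst z)"] by simp
    also have "\<dots> = (\<integral>\<^sup>+x. indicator A x \<partial>distr \<pi> ?M fst)" by (subst nn_integral_distr) auto
    also have "\<dots> = (\<integral>\<^sup>+x. 1 * indicator A x \<partial>Q)" by (simp add: fst_\<pi>)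
    finally show "(\<integral>\<^sup>+x. (\<Sum>l\<in>I. f0 l x) * indicator A x \<partial>Q) = (\<integral>\<^sup>+x. 1 * indicator A x \<partial>Q)" .
  qed auto
  have mass: "(\<integral>\<^sup>+x. f0 l x \<partial>Q) = ennreal (1 / real (card I))" if l: "l \<in> I" for l
  proof -
    have "(\<integral>\<^sup>+x. f0 l x \<partial>Q) = ennreal (1 / real (n l)) * (\<integral>\<^sup>+z. slice l z \<partial>\<pi>)"
      using g[OF l, of "\<lambda>_. 1"] by (simp add: f0_def nn_integral_cmult)
    also have "(\<integral>\<^sup>+z. slice l z \<partial>\<pi>) = (\<integral>\<^sup>+y. indicator {w l} y \<partial>distr \<pi> ?M snd)"
      using l by (subst nn_integral_distr) (auto simp: slice_def[abs_def])
    also have "\<dots> = ennreal (real (n l) / real (card I))"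
      using emeasure_empirical[OF I(1) sing[OF l], of w] sing[OF l] by (simp add: snd_\<pi> n_def)
    also have "ennreal (1 / real (n l)) * ennreal (real (n l) / real (card I)) = ennreal (1 / real (card I))"
      using n_pos[OF l] by (simp flip: ennreal_mult)
    finally show ?thesis .
  qed
  \<comment> \<open>On the null set where the total is not 1, the uniform value
    \<open>1 / card I\<close> restores the pointwise constraint. Elsewhere every
    \<open>f0 l x\<close> is finite, so \<open>enn2real\<close> loses nothing.\<close>
  define f where "f l x = (if (\<Sum>l\<in>I. f0 l x) = 1 then enn2real (f0 l x) else 1 / real (card I))" for l x
  have f_meas [measurable]: "f l \<in> borel_measurable Q" for l unfolding f_def by measurable
  have fin: "f0 l x < \<top>" if "l \<in> I" "(\<Sum>l\<in>I. f0 l x) = 1" for l x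
  proof -
    have "f0 l x \<le> (\<Sum>l\<in>I. f0 l x)"
      using that I by (intro member_le_sum) auto
    then show ?thesis using that by (simp add: order.strict_trans1)
  qed
  have f_eq: "AE x in Q. \<forall>l\<in>I. ennreal (f l x) = f0 l x"
    using sum1 by eventually_elim (auto simp: f_def fin)
  have "semidiscrete_plan Q I f"
    unfolding semidiscrete_plan_def
  proof (intro conjI ballI allI)
    fix l x assume l: "l \<in> I"
    show "f l \<in> borel_measurable Q" by measurable
    show "0 \<le> f l x" by (simp add: f_def)
    have "(\<integral>\<^sup>+x. ennreal (f l x) \<partial>Q) = ennreal (1 / real (card I))"
      using l f_eq by (subst mass[OF l, symmetric]) (intro nn_integral_cong_AE, auto)
    then show "(\<integral>x. f l x \<partial>Q) = 1 / real (card I)"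
      by (subst integral_eq_nn_integral) (auto simp: f_def)
  next
    fix x show "(\<Sum>l\<in>I. f l x) = 1"
    proof (cases "(\<Sum>l\<in>I. f0 l x) = 1")
      case True
      then have f_x: "f l x = enn2real (f0 l x)" for l by (simp add: f_def)
      have "ennreal (\<Sum>l\<in>I. f l x) = (\<Sum>l\<in>I. ennreal (f l x))" by (simp add: f_x sum_ennreal)
      also have "\<dots> = (\<Sum>l\<in>I. f0 l x)" using fin[OF _ True] by (intro sum.cong) (simp_all add: f_x)
      finally show ?thesis using True by simp
    qed (use I in \<open>simp add: f_def\<close>)
  qed
  moreover have "plan_cost Q I (\<lambda>l x. h (x, w l)) f = (\<integral>\<^sup>+z. ennreal (h z) \<partial>\<pi>)"
  proof -
    have "plan_cost Q I (\<lambda>l x. h (x, w l)) f = (\<Sum>l\<in>I. \<integral>\<^sup>+x. f0 l x * ennreal (h (x, w l)) \<partial>Q)"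
      unfolding plan_cost_def
    proof (intro sum.cong refl nn_integral_cong_AE)
      fix l assume l: "l \<in> I"
      show "AE x in Q. ennreal (f l x * h (x, w l)) = f0 l x * ennreal (h (x, w l))"
        using f_eq by eventually_elim (use l h in \<open>auto simp: ennreal_mult f_def\<close>)
    qed
    also have "\<dots> = (\<integral>\<^sup>+z. ennreal (h z) \<partial>\<pi>)" using h(1) by (intro f0) auto
    finally show ?thesis .
  qed
  ultimately show ?thesis by blast
qed

section \<open>Restricting a plan to a subset of the data points\<close>

text \<open>The distribution of the starting point, given that the plan moves it to a data point of
  \<open>J\<close>. That event has probability \<open>card J / card I\<close>, whence the
  factor.\<close>

definition subplan_marginal :: "'a measure \<Rightarrow> 'i set \<Rightarrow> ('i \<Rightarrow> 'a \<Rightarrow> real) \<Rightarrow> 'i set \<Rightarrow> 'a measure" where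
  "subplan_marginal Q I f J =
     density Q (\<lambda>x. \<Sum>l\<in>J. ennreal (real (card I) / real (card J)) * ennreal (f l x))"

text \<open>The part of the plan that ends in \<open>J\<close>, rescaled, is a coupling: each
  \<open>l\<close> in \<open>J\<close> receives \<open>card I / card J\<close> times
  \<open>1 / card I\<close>, which is its mass in the empirical measure of \<open>J\<close>. The
  bound is the cost of this coupling, which need not be optimal.\<close>

lemma subplan_wasserstein:
  fixes \<Xi> :: "'a::euclidean_space set"
  assumes Q: "Q \<in> prob_measures \<Xi>" and f: "semidiscrete_plan Q I f"
    and J: "J \<subseteq> I" "J \<noteq> {}" and w: "\<And>l. l \<in> J \<Longrightarrow> w l \<in> \<Xi>" and nrm: "is_norm nrm"
  shows "subplan_marginal Q I f J \<in> prob_measures \<Xi>" (is ?thesis1)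
    and "wasserstein \<Xi> nrm (subplan_marginal Q I f J) (empirical \<Xi> w J)
      \<le> ennreal (real (card I) / real (card J)) * plan_cost Q J (\<lambda>l x. nrm (x - w l)) f" (is ?thesis2)
proof -
  let ?M = "borel_on \<Xi>" and ?a = "real (card I) / real (card J)"
  have finI: "finite I" using semidiscrete_plan_finite[OF f] .
  then have cJ: "0 < card J" and cI: "0 < card I"
    using J finite_subset by (auto simp: card_gt_0_iff)
  interpret Q: prob_space Q using Q by (simp add: prob_measures_def)
  have sets_Q [measurable_cong]: "sets Q = sets ?M" using Q by (simp add: prob_measures_def)
  have space_M: "space ?M = \<Xi>" by (simp add: space_restrict_space)
  have space_Q: "space Q = \<Xi>" using sets_eq_imp_space_eq[OF sets_Q] by (simp add: space_M)
  have f_meas [measurable]: "f l \<in> borel_measurable Q" if "l \<in> J" for l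
    using semidiscrete_planD(1)[OF f] that J by auto
  have f_nonneg: "0 \<le> f l x" if "l \<in> J" for l x
    using semidiscrete_planD(2)[OF f] that J by auto
  have mass: "(\<integral>\<^sup>+x. ennreal (f l x) \<partial>Q) = ennreal (1 / real (card I))" if "l \<in> J" for l
    using that J f f_nonneg Q.semidiscrete_plan_integrable[OF f, of l] semidiscrete_planD(3)[OF f, of l]
    by (subst nn_integral_eq_integral) auto
  have pair: "(\<lambda>x. (x, w l)) \<in> ?M \<rightarrow>\<^sub>M ?M \<Otimes>\<^sub>M ?M" if "l \<in> J" for l
    using w[OF that] by (intro measurable_Pair) (auto simp: space_M)
  \<comment> \<open>\<open>\<rho> l\<close> is the product of the measure with density
    \<open>f l\<close> and the point mass at \<open>w l\<close>; the weighted sum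
    \<open>\<pi>\<close> of these is the rescaled restricted plan.\<close>
  define \<rho> where "\<rho> l = distr (density Q (\<lambda>x. ennreal (f l x))) (?M \<Otimes>\<^sub>M ?M) (\<lambda>x. (x, w l))" for l
  define \<pi> where "\<pi> = weighted_sum (?M \<Otimes>\<^sub>M ?M) J (\<lambda>_. ?a) \<rho>"
  have sets_\<rho>: "sets (\<rho> l) = sets (?M \<Otimes>\<^sub>M ?M)" for l by (simp add: \<rho>_def)
  have sets_\<pi> [measurable_cong]: "sets \<pi> = sets (?M \<Otimes>\<^sub>M ?M)" by (simp add: \<pi>_def)
  have \<pi>: "(\<integral>\<^sup>+z. H z \<partial>\<pi>) = (\<Sum>l\<in>J. ennreal ?a * (\<integral>\<^sup>+x. ennreal (f l x) * H (x, w l) \<partial>Q))"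
    if H [measurable]: "H \<in> borel_measurable (?M \<Otimes>\<^sub>M ?M)" for H
  proof -
    have "(\<integral>\<^sup>+z. H z \<partial>\<rho> l) = (\<integral>\<^sup>+x. ennreal (f l x) * H (x, w l) \<partial>Q)" if l: "l \<in> J" for l
    proof -
      have "(\<lambda>x. (x, w l)) \<in> density Q (\<lambda>x. ennreal (f l x)) \<rightarrow>\<^sub>M ?M \<Otimes>\<^sub>M ?M"
        using pair[OF l] by (subst measurable_cong_sets[OF _ refl]) (simp_all add: sets_Q)
      then have "(\<integral>\<^sup>+z. H z \<partial>\<rho> l) = (\<integral>\<^sup>+x. H (x, w l) \<partial>density Q (\<lambda>x. ennreal (f l x)))"
        unfolding \<rho>_def using H by (intro nn_integral_distr) simp_all
      also have "\<dots> = (\<integral>\<^sup>+x. ennreal (f l x) * H (x, w l) \<partial>Q)"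
      proof (rule nn_integral_density)
        show "(\<lambda>x. ennreal (f l x)) \<in> borel_measurable Q" using f_meas[OF l] by simp
        show "(\<lambda>x. H (x, w l)) \<in> borel_measurable Q"
          using measurable_compose[OF pair[OF l] H] by (simp add: measurable_cong_sets[OF sets_Q refl])
      qed
      finally show ?thesis .
    qed
    then show ?thesis
      unfolding \<pi>_def using sets_\<rho> H by (simp add: nn_integral_weighted_sum)
  qed
  have total: "(\<Sum>l\<in>J. ennreal ?a * (\<integral>\<^sup>+x. ennreal (f l x) \<partial>Q)) = 1"
  proof -
    have "(\<Sum>l\<in>J. ennreal ?a * (\<integral>\<^sup>+x. ennreal (f l x) \<partial>Q)) = (\<Sum>l\<in>J. ennreal (1 / real (card J)))"
      using cI by (intro sum.cong) (simp_all add: mass flip: ennreal_mult)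
    also have "\<dots> = 1" using cJ by (subst sum_ennreal) auto
    finally show ?thesis .
  qed
  have marginal: "emeasure (subplan_marginal Q I f J) A
      = (\<Sum>l\<in>J. ennreal ?a * (\<integral>\<^sup>+x. ennreal (f l x) * indicator A x \<partial>Q))" if [measurable]: "A \<in> sets ?M" for A
  proof -
    have "emeasure (subplan_marginal Q I f J) A
        = (\<integral>\<^sup>+x. (\<Sum>l\<in>J. ennreal ?a * ennreal (f l x)) * indicator A x \<partial>Q)"
      unfolding subplan_marginal_def by (rule emeasure_density) measurable
    also have "\<dots> = (\<integral>\<^sup>+x. (\<Sum>l\<in>J. ennreal ?a * (ennreal (f l x) * indicator A x)) \<partial>Q)"
      by (simp only: sum_distrib_right mult.assoc)
    also have "\<dots> = (\<Sum>l\<in>J. \<integral>\<^sup>+x. ennreal ?a * (ennreal (f l x) * indicator A x) \<partial>Q)"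
      by (rule nn_integral_sum) measurable
    finally show ?thesis by (simp add: nn_integral_cmult)
  qed
  have sets_marg: "sets (subplan_marginal Q I f J) = sets ?M" by (simp add: subplan_marginal_def sets_Q)
  have "emeasure (subplan_marginal Q I f J) \<Xi> = 1"
  proof -
    have "(\<integral>\<^sup>+x. ennreal (f l x) * indicator \<Xi> x \<partial>Q) = (\<integral>\<^sup>+x. ennreal (f l x) \<partial>Q)" for l
      by (intro nn_integral_cong) (simp add: space_Q)
    then show ?thesis using marginal[of \<Xi>] total sets.top[of ?M] by (simp add: space_M)
  qed
  then show ?thesis1
    using sets_marg sets_eq_imp_space_eq[OF sets_marg] by (auto simp: prob_measures_def space_M intro!: prob_spaceI)
  have "\<pi> \<in> couplings \<Xi> (subplan_marginal Q I f J) (empirical \<Xi> w J)"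
    unfolding couplings_def mem_Collect_eq
  proof (intro conjI)
    have "emeasure \<pi> (space \<pi>) = (\<integral>\<^sup>+z. 1 \<partial>\<pi>)" by simp
    also have "\<dots> = 1" using total by (subst \<pi>) simp_all
    finally show "prob_space \<pi>" by (rule prob_spaceI)
    show "distr \<pi> ?M fst = subplan_marginal Q I f J"
    proof (rule measure_eqI)
      fix A assume "A \<in> sets (distr \<pi> ?M fst)"
      then have [measurable]: "A \<in> sets ?M" by simp
      have "emeasure (distr \<pi> ?M fst) A = (\<integral>\<^sup>+x. indicator A x \<partial>distr \<pi> ?M fst)" by simp
      also have "\<dots> = (\<integral>\<^sup>+z. indicator A (fst z) \<partial>\<pi>)" by (subst nn_integral_distr) auto
      also have "\<dots> = emeasure (subplan_marginal Q I f J) A" by (subst \<pi>) (simp_all add: marginal)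
      finally show "emeasure (distr \<pi> ?M fst) A = emeasure (subplan_marginal Q I f J) A" .
    qed (simp add: sets_marg)
    show "distr \<pi> ?M snd = empirical \<Xi> w J"
    proof (rule measure_eqI)
      fix A assume "A \<in> sets (distr \<pi> ?M snd)"
      then have A [measurable]: "A \<in> sets ?M" by simp
      have "emeasure (distr \<pi> ?M snd) A = (\<integral>\<^sup>+x. indicator A x \<partial>distr \<pi> ?M snd)" by simp
      also have "\<dots> = (\<integral>\<^sup>+z. indicator A (snd z) \<partial>\<pi>)" by (subst nn_integral_distr) auto
      also have "\<dots> = (\<Sum>l\<in>J. ennreal ?a * (\<integral>\<^sup>+x. ennreal (f l x) * indicator A (w l) \<partial>Q))"
        by (subst \<pi>) simp_all
      also have "\<dots> = (\<Sum>l\<in>J. ennreal (1 / real (card J)) * indicator A (w l))"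
      proof (intro sum.cong refl)
        fix l assume l: "l \<in> J"
        have "ennreal ?a * (\<integral>\<^sup>+x. ennreal (f l x) * indicator A (w l) \<partial>Q)
            = (ennreal ?a * ennreal (1 / real (card I))) * indicator A (w l)"
          using l by (simp add: nn_integral_multc mass mult.assoc)
        also have "ennreal ?a * ennreal (1 / real (card I)) = ennreal (1 / real (card J))"
          using cI by (simp flip: ennreal_mult)
        finally show "ennreal ?a * (\<integral>\<^sup>+x. ennreal (f l x) * indicator A (w l) \<partial>Q)
          = ennreal (1 / real (card J)) * indicator A (w l)" .
      qed
      also have "\<dots> = emeasure (empirical \<Xi> w J) A"
        using A by (simp add: empirical_def emeasure_weighted_sum)
      finally show "emeasure (distr \<pi> ?M snd) A = emeasure (empirical \<Xi> w J) A" .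
    qed simp
  qed (rule sets_\<pi>)
  then have "wasserstein \<Xi> nrm (subplan_marginal Q I f J) (empirical \<Xi> w J)
      \<le> (\<integral>\<^sup>+z. ennreal (nrm (fst z - snd z)) \<partial>\<pi>)"
    unfolding wasserstein_def by (rule INF_lower)
  also have "\<dots> = (\<Sum>l\<in>J. ennreal ?a * (\<integral>\<^sup>+x. ennreal (f l x) * ennreal (nrm (x - w l)) \<partial>Q))"
    using borel_measurable_cost[OF nrm] by (subst \<pi>) auto
  also have "\<dots> = ennreal ?a * plan_cost Q J (\<lambda>l x. nrm (x - w l)) f"
    using f_nonneg nrm by (simp add: plan_cost_def sum_distrib_left ennreal_mult is_norm_def)
  finally show ?thesis2 .
qed

text \<open>Couplings of cost below \<open>t + e\<close> give plans of cost at most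
  \<open>t + e\<close>, and compactness of the minimizing sequence removes \<open>e\<close>. A
  single plan of cost at most \<open>t\<close> is what allows \<open>Q\<close> to be split once and
  for all.\<close>

lemma wasserstein_le_imp_plan:
  fixes \<Xi> :: "'a::euclidean_space set"
  assumes I: "finite I" "I \<noteq> {}" and w: "\<And>l. l \<in> I \<Longrightarrow> w l \<in> \<Xi>" and nrm: "is_norm nrm"
    and Q: "Q \<in> wasserstein_ball \<Xi> nrm t (empirical \<Xi> w I)" and "0 \<le> t"
  shows "\<exists>f. semidiscrete_plan Q I f \<and> plan_cost Q I (\<lambda>l x. nrm (x - w l)) f \<le> ennreal t"
proof -
  have Q': "Q \<in> prob_measures \<Xi>" and W: "wasserstein \<Xi> nrm Q (empirical \<Xi> w I) \<le> ennreal t"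
    using Q by (simp_all add: wasserstein_ball_def)
  interpret Q: prob_space Q using Q' by (simp add: prob_measures_def)
  have sets_Q: "sets Q = sets (borel_on \<Xi>)" using Q' by (simp add: prob_measures_def)
  show ?thesis
  proof (rule Q.optimal_plan_exists)
    show "(\<lambda>x. nrm (x - w l)) \<in> borel_measurable Q" if "l \<in> I" for l
    proof -
      have "(\<lambda>x. (x, w l)) \<in> borel_on \<Xi> \<rightarrow>\<^sub>M borel_on \<Xi> \<Otimes>\<^sub>M borel_on \<Xi>"
        using w[OF that] by (intro measurable_Pair) (auto simp: space_restrict_space)
      from measurable_compose[OF this borel_measurable_cost[OF nrm]] show ?thesis
        using sets_Q by (simp cong: measurable_cong_sets)
    qed
    show "0 \<le> nrm (x - w l)" for l x using nrm by (simp add: is_norm_def)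
    fix e :: real assume "0 < e"
    then have "wasserstein \<Xi> nrm Q (empirical \<Xi> w I) < ennreal (t + e)"
      using W \<open>0 \<le> t\<close> by (auto intro: order.strict_trans1 ennreal_lessI)
    then obtain \<pi> where \<pi>: "\<pi> \<in> couplings \<Xi> Q (empirical \<Xi> w I)"
      and cost: "(\<integral>\<^sup>+z. ennreal (nrm (fst z - snd z)) \<partial>\<pi>) < ennreal (t + e)"
      by (auto simp: wasserstein_def INF_less_iff)
    show "\<exists>f. semidiscrete_plan Q I f \<and> plan_cost Q I (\<lambda>l x. nrm (x - w l)) f \<le> ennreal (t + e)"
      using coupling_imp_plan[OF I w Q' \<pi> borel_measurable_cost[OF nrm]] cost nrm
      by (force simp: is_norm_def)
  qed
qed

section \<open>Convexity of the Wasserstein distance\<close>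

lemma distr_weighted_sum:
  assumes sets: "\<And>i. i \<in> I \<Longrightarrow> sets (Q i) = sets M" and g [measurable]: "g \<in> M \<rightarrow>\<^sub>M L"
  shows "distr (weighted_sum M I a Q) L g = weighted_sum L I a (\<lambda>i. distr (Q i) L g)"
proof (rule measure_eqI)
  fix A assume "A \<in> sets (distr (weighted_sum M I a Q) L g)"
  then have A [measurable]: "A \<in> sets L" by simp
  have gQ: "g \<in> Q i \<rightarrow>\<^sub>M L" if "i \<in> I" for i using g sets[OF that] by (simp cong: measurable_cong_sets)
  have g': "g \<in> weighted_sum M I a Q \<rightarrow>\<^sub>M L" using g by (simp cong: measurable_cong_sets)
  have "emeasure (distr (weighted_sum M I a Q) L g) A
      = (\<Sum>i\<in>I. ennreal (a i) * emeasure (Q i) (g -` A \<inter> space M))"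
    using A g' g by (simp add: emeasure_distr emeasure_weighted_sum[OF sets])
  also have "\<dots> = (\<Sum>i\<in>I. ennreal (a i) * emeasure (distr (Q i) L g) A)"
    using A gQ sets_eq_imp_space_eq[OF sets] by (intro sum.cong refl) (simp add: emeasure_distr)
  finally show "emeasure (distr (weighted_sum M I a Q) L g) A
      = emeasure (weighted_sum L I a (\<lambda>i. distr (Q i) L g)) A"
    using A by (simp add: emeasure_weighted_sum)
qed simp

lemma weighted_sum_cong:
  "(\<And>i. i \<in> I \<Longrightarrow> Q i = P i) \<Longrightarrow> weighted_sum M I a Q = weighted_sum M I a P"
  by (simp add: weighted_sum_def cong: sum.cong)

text \<open>Mixing near-optimal couplings of \<open>Q i\<close> and \<open>P i\<close> with the
  weights \<open>a i\<close> gives a coupling of the mixtures whose cost is the mixed cost. Only a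
  bound on the distance is sought here, so attainment of the infimum is not at issue.\<close>

lemma wasserstein_weighted_sum_le:
  fixes \<Xi> :: "'a::euclidean_space set"
  assumes a: "\<And>i. i \<in> I \<Longrightarrow> 0 \<le> a i" "(\<Sum>i\<in>I. a i) = 1" and nrm: "is_norm nrm" and "0 \<le> t"
    and W: "\<And>i. i \<in> I \<Longrightarrow> wasserstein \<Xi> nrm (Q i) (P i) \<le> ennreal t"
  shows "wasserstein \<Xi> nrm (weighted_sum (borel_on \<Xi>) I a Q) (weighted_sum (borel_on \<Xi>) I a P) \<le> ennreal t"
proof (rule ennreal_le_epsilon)
  let ?M = "borel_on \<Xi>"
  fix e :: real assume "0 < e"
  have "\<exists>\<pi>\<in>couplings \<Xi> (Q i) (P i). (\<integral>\<^sup>+z. ennreal (nrm (fst z - snd z)) \<partial>\<pi>) < ennreal (t + e)" if "i \<in> I" for i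
  proof -
    have "wasserstein \<Xi> nrm (Q i) (P i) < ennreal (t + e)"
      using W[OF that] \<open>0 < e\<close> \<open>0 \<le> t\<close> by (auto intro: order.strict_trans1 ennreal_lessI)
    then show ?thesis by (simp add: wasserstein_def INF_less_iff)
  qed
  then obtain \<pi> where \<pi>: "\<And>i. i \<in> I \<Longrightarrow> \<pi> i \<in> couplings \<Xi> (Q i) (P i)"
    and cost: "\<And>i. i \<in> I \<Longrightarrow> (\<integral>\<^sup>+z. ennreal (nrm (fst z - snd z)) \<partial>\<pi> i) < ennreal (t + e)"
    by metis
  have sets_\<pi>: "sets (\<pi> i) = sets (?M \<Otimes>\<^sub>M ?M)" and prob: "prob_space (\<pi> i)"
    and marg: "distr (\<pi> i) ?M fst = Q i" "distr (\<pi> i) ?M snd = P i" if "i \<in> I" for i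
    using \<pi>[OF that] by (simp_all add: couplings_def)
  define \<tau> where "\<tau> = weighted_sum (?M \<Otimes>\<^sub>M ?M) I a \<pi>"
  have "\<tau> \<in> couplings \<Xi> (weighted_sum ?M I a Q) (weighted_sum ?M I a P)"
    unfolding couplings_def mem_Collect_eq \<tau>_def
    using prob_space_weighted_sum[OF sets_\<pi> prob a] marg
    by (simp add: distr_weighted_sum[OF sets_\<pi>] cong: weighted_sum_cong)
  then have "wasserstein \<Xi> nrm (weighted_sum ?M I a Q) (weighted_sum ?M I a P)
      \<le> (\<integral>\<^sup>+z. ennreal (nrm (fst z - snd z)) \<partial>\<tau>)"
    unfolding wasserstein_def by (rule INF_lower)
  also have "\<dots> = (\<Sum>i\<in>I. ennreal (a i) * (\<integral>\<^sup>+z. ennreal (nrm (fst z - snd z)) \<partial>\<pi> i))"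
    unfolding \<tau>_def using borel_measurable_cost[OF nrm] by (intro nn_integral_weighted_sum sets_\<pi>) auto
  also have "\<dots> \<le> (\<Sum>i\<in>I. ennreal (a i) * ennreal (t + e))"
    using cost by (intro sum_mono mult_left_mono) (auto intro: less_imp_le)
  also have "\<dots> = (\<Sum>i\<in>I. ennreal (a i)) * ennreal (t + e)" by (simp add: sum_distrib_right)
  also have "(\<Sum>i\<in>I. ennreal (a i)) = 1" using a by (simp add: sum_ennreal)
  finally show "wasserstein \<Xi> nrm (weighted_sum ?M I a Q) (weighted_sum ?M I a P) \<le> ennreal t + ennreal e"
    using \<open>0 < e\<close> \<open>0 \<le> t\<close> by simp
qed

section \<open>Reassembling the whole from the clusters\<close>

text \<open>The weight of a cluster cancels its size, so every data point ends up with the same mass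
  in the union.\<close>

lemma empirical_UN:
  assumes S: "finite S" "disjoint_family_on C S" "\<And>k. k \<in> S \<Longrightarrow> C k \<noteq> {}" "\<And>k. k \<in> S \<Longrightarrow> finite (C k)"
  shows "weighted_sum (borel_on \<Xi>) S (\<lambda>k. real (card (C k)) / real (card (\<Union>k\<in>S. C k))) (\<lambda>k. empirical \<Xi> w (C k))
    = empirical \<Xi> w (\<Union>k\<in>S. C k)" (is "?L = ?R")
proof (rule measure_eqI)
  let ?U = "\<Union>k\<in>S. C k"
  fix A assume "A \<in> sets ?L"
  then have A: "A \<in> sets (borel_on \<Xi>)" by simp
  have "emeasure ?L A = (\<Sum>k\<in>S. ennreal (real (card (C k)) / real (card ?U)) * emeasure (empirical \<Xi> w (C k)) A)"
    using A by (intro emeasure_weighted_sum) auto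
  also have "\<dots> = (\<Sum>k\<in>S. \<Sum>l\<in>C k. ennreal (1 / real (card ?U)) * indicator A (w l))"
  proof (intro sum.cong refl)
    fix k assume k: "k \<in> S"
    have "card (C k) > 0" using S k by (simp add: card_gt_0_iff)
    then have "ennreal (real (card (C k)) / real (card ?U)) * ennreal (1 / real (card (C k))) = ennreal (1 / real (card ?U))"
      by (simp flip: ennreal_mult)
    then show "ennreal (real (card (C k)) / real (card ?U)) * emeasure (empirical \<Xi> w (C k)) A
        = (\<Sum>l\<in>C k. ennreal (1 / real (card ?U)) * indicator A (w l))"
      using A by (simp add: empirical_def emeasure_weighted_sum sum_distrib_left flip: mult.assoc)
  qed
  also have "\<dots> = (\<Sum>l\<in>?U. ennreal (1 / real (card ?U)) * indicator A (w l))"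
    using S by (intro sum.UNION_disjoint[symmetric]) (auto simp: disjoint_family_on_def)
  also have "\<dots> = emeasure ?R A"
    using A by (simp add: empirical_def emeasure_weighted_sum)
  finally show "emeasure ?L A = emeasure ?R A" .
qed simp

text \<open>The weight of a cluster cancels the rescaling factor in \<open>subplan_marginal\<close>.
  What remains is \<open>Q\<close> with the density obtained by summing all \<open>f l\<close>,
  which is 1.\<close>

lemma weighted_sum_subplan_marginals:
  assumes Q: "prob_space Q" "sets Q = sets M" and f: "semidiscrete_plan Q (\<Union>k\<in>S. C k) f"
    and S: "finite S" "disjoint_family_on C S" "\<And>k. k \<in> S \<Longrightarrow> C k \<noteq> {}" "\<And>k. k \<in> S \<Longrightarrow> finite (C k)"
  shows "weighted_sum M S (\<lambda>k. real (card (C k)) / real (card (\<Union>k\<in>S. C k)))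
      (\<lambda>k. subplan_marginal Q (\<Union>k\<in>S. C k) f (C k)) = Q" (is "?L = Q")
proof (rule measure_eqI)
  let ?U = "\<Union>k\<in>S. C k"
  have f_meas: "f l \<in> borel_measurable Q" and f_nonneg: "0 \<le> f l x" if "k \<in> S" "l \<in> C k" for k l x
    using semidiscrete_planD[OF f, of l] that by auto
  fix A assume "A \<in> sets ?L"
  then have A: "A \<in> sets M" by simp
  then have AQ [measurable]: "A \<in> sets Q" using Q by simp
  have "emeasure ?L A = (\<Sum>k\<in>S. ennreal (real (card (C k)) / real (card ?U)) * emeasure (subplan_marginal Q ?U f (C k)) A)"
    using A Q by (intro emeasure_weighted_sum) (auto simp: subplan_marginal_def)
  also have "\<dots> = (\<Sum>k\<in>S. \<Sum>l\<in>C k. \<integral>\<^sup>+x. ennreal (f l x) * indicator A x \<partial>Q)"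
  proof (intro sum.cong refl)
    fix k assume k: "k \<in> S"
    have [measurable]: "f l \<in> borel_measurable Q" if "l \<in> C k" for l using f_meas k that .
    have "finite ?U" using semidiscrete_plan_finite[OF f] .
    moreover have "C k \<subseteq> ?U" "C k \<noteq> {}" using k S by auto
    ultimately have pos: "0 < card (C k)" "0 < card ?U" by (auto simp: card_gt_0_iff finite_subset)
    have "emeasure (subplan_marginal Q ?U f (C k)) A
        = (\<integral>\<^sup>+x. (\<Sum>l\<in>C k. ennreal (real (card ?U) / real (card (C k))) * ennreal (f l x)) * indicator A x \<partial>Q)"
      unfolding subplan_marginal_def by (rule emeasure_density) measurable
    also have "\<dots> = (\<integral>\<^sup>+x. (\<Sum>l\<in>C k. ennreal (real (card ?U) / real (card (C k))) * (ennreal (f l x) * indicator A x)) \<partial>Q)"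
      by (simp add: sum_distrib_right mult.assoc)
    also have "\<dots> = ennreal (real (card ?U) / real (card (C k))) * (\<Sum>l\<in>C k. \<integral>\<^sup>+x. ennreal (f l x) * indicator A x \<partial>Q)"
      by (simp add: nn_integral_sum nn_integral_cmult sum_distrib_left)
    finally have "ennreal (real (card (C k)) / real (card ?U)) * emeasure (subplan_marginal Q ?U f (C k)) A
        = (ennreal (real (card (C k)) / real (card ?U)) * ennreal (real (card ?U) / real (card (C k))))
          * (\<Sum>l\<in>C k. \<integral>\<^sup>+x. ennreal (f l x) * indicator A x \<partial>Q)"
      by (simp add: mult.assoc)
    also have "ennreal (real (card (C k)) / real (card ?U)) * ennreal (real (card ?U) / real (card (C k))) = 1"
      using pos by (subst ennreal_mult[symmetric]) auto
    finally show "ennreal (real (card (C k)) / real (card ?U)) * emeasure (subplan_marginal Q ?U f (C k)) A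
        = (\<Sum>l\<in>C k. \<integral>\<^sup>+x. ennreal (f l x) * indicator A x \<partial>Q)" by simp
  qed
  also have "\<dots> = (\<Sum>l\<in>?U. \<integral>\<^sup>+x. ennreal (f l x) * indicator A x \<partial>Q)"
    using S by (intro sum.UNION_disjoint[symmetric]) (auto simp: disjoint_family_on_def)
  also have "\<dots> = (\<integral>\<^sup>+x. (\<Sum>l\<in>?U. ennreal (f l x) * indicator A x) \<partial>Q)"
    using f_meas by (intro nn_integral_sum[symmetric]) auto
  also have "\<dots> = (\<integral>\<^sup>+x. indicator A x \<partial>Q)"
  proof (intro nn_integral_cong)
    fix x
    have "(\<Sum>l\<in>?U. ennreal (f l x)) = ennreal (\<Sum>l\<in>?U. f l x)"
      using f_nonneg by (intro sum_ennreal) auto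
    also have "\<dots> = 1" using f by (simp add: semidiscrete_plan_def)
    finally show "(\<Sum>l\<in>?U. ennreal (f l x) * indicator A x) = indicator A x"
      by (simp flip: sum_distrib_right)
  qed
  also have "\<dots> = emeasure Q A" by simp
  finally show "emeasure ?L A = emeasure Q A" .
qed (simp add: Q)

section \<open>Both inclusions between the ambiguity set and the Wasserstein balls\<close>

theorem theorem1:
  fixes \<Xi> :: "(real ^ 'm) set"
    and nrm :: "real ^ 'm \<Rightarrow> real"
    and N K :: nat
    and w :: "nat \<Rightarrow> real ^ 'm"
    and C :: "nat \<Rightarrow> nat set"
    and \<theta> :: "nat \<Rightarrow> real"
  assumes "is_norm nrm"
    and "1 \<le> N" and "1 \<le> K"
    and "\<And>l. l \<in> {1..N} \<Longrightarrow> w l \<in> \<Xi>"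
    and "(\<Union>k\<in>{1..K}. C k) = {1..N}"
    and "disjoint_family_on C {1..K}"
    and "\<And>k. k \<in> {1..K} \<Longrightarrow> C k \<noteq> {}"
    and "\<And>k. k \<in> {1..K} \<Longrightarrow> 0 < \<theta> k"
  shows "wasserstein_ball \<Xi> nrm (MIN k\<in>{1..K}. real (card (C k)) / real N * \<theta> k)
            (empirical \<Xi> w {1..N})
          \<subseteq> ambiguity_set \<Xi> nrm N w K C \<theta>
       \<and> ambiguity_set \<Xi> nrm N w K C \<theta>
          \<subseteq> wasserstein_ball \<Xi> nrm (MAX k\<in>{1..K}. \<theta> k) (empirical \<Xi> w {1..N})"
proof
  let ?p = "\<lambda>k. real (card (C k)) / real N"
  let ?lo = "MIN k\<in>{1..K}. ?p k * \<theta> k" and ?hi = "MAX k\<in>{1..K}. \<theta> k"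
  have U: "(\<Union>k\<in>{1..K}. C k) = {1..N}" by fact
  have sub: "C k \<subseteq> {1..N}" if "k \<in> {1..K}" for k using that U by blast
  have fin: "finite (C k)" if "k \<in> {1..K}" for k using sub[OF that] finite_subset by blast
  have card_pos: "0 < card (C k)" if "k \<in> {1..K}" for k
    using fin[OF that] assms(7)[OF that] by (simp add: card_gt_0_iff)
  have "(\<Sum>k\<in>{1..K}. card (C k)) = card (\<Union>k\<in>{1..K}. C k)"
    using assms(6) fin by (intro card_UN_disjoint'[symmetric]) auto
  also have "\<dots> = N" by (simp only: U card_atLeastAtMost)
  finally have "(\<Sum>k\<in>{1..K}. real (card (C k))) = real N" by (simp flip: of_nat_sum)
  then have p_sum: "(\<Sum>k\<in>{1..K}. ?p k) = 1" using assms(2) by (simp flip: sum_divide_distrib)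
  show "wasserstein_ball \<Xi> nrm ?lo (empirical \<Xi> w {1..N}) \<subseteq> ambiguity_set \<Xi> nrm N w K C \<theta>"
  proof
    fix Q assume Q: "Q \<in> wasserstein_ball \<Xi> nrm ?lo (empirical \<Xi> w {1..N})"
    then have Q': "Q \<in> prob_measures \<Xi>" by (simp add: wasserstein_ball_def)
    have lo: "?lo \<le> ?p k * \<theta> k" if "k \<in> {1..K}" for k using that by (intro Min_le) auto
    \<comment> \<open>The minimum is the value at some cluster and therefore nonnegative, as needed
      to extract an optimal plan.\<close>
    have "?lo \<in> (\<lambda>k. ?p k * \<theta> k) ` {1..K}" using assms(3) by (intro Min_in) auto
    then obtain k where k: "k \<in> {1..K}" and "?lo = ?p k * \<theta> k" by (rule imageE)
    moreover have "0 \<le> ?p k * \<theta> k" using assms(8)[OF k] by simp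
    ultimately have "0 \<le> ?lo" by (simp only:)
    then obtain f where f: "semidiscrete_plan Q {1..N} f"
      and cost: "plan_cost Q {1..N} (\<lambda>l x. nrm (x - w l)) f \<le> ennreal ?lo"
      using wasserstein_le_imp_plan[OF _ _ assms(4,1) Q] assms(2) by auto
    let ?Q = "\<lambda>k. subplan_marginal Q {1..N} f (C k)"
    have "?Q k \<in> wasserstein_ball \<Xi> nrm (\<theta> k) (empirical \<Xi> w (C k))" if k: "k \<in> {1..K}" for k
    proof -
      note W = subplan_wasserstein[OF Q' f sub[OF k] assms(7)[OF k] _ assms(1), of w]
      have w: "w l \<in> \<Xi>" if "l \<in> C k" for l using sub[OF k] that assms(4) by auto
      have "wasserstein \<Xi> nrm (?Q k) (empirical \<Xi> w (C k))
          \<le> ennreal (real N / real (card (C k))) * plan_cost Q (C k) (\<lambda>l x. nrm (x - w l)) f"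
        using W(2)[OF w] by simp
      \<comment> \<open>The cluster pays at most the total cost, hence at most \<open>?lo\<close>,
        and conditioning on the cluster divides by its weight \<open>?p k\<close>. The lower radius
        is the largest one for which this stays below \<open>\<theta> k\<close> for every
        \<open>k\<close>.\<close>
      also have "\<dots> \<le> ennreal (real N / real (card (C k))) * ennreal (?p k * \<theta> k)"
        by (intro mult_left_mono order_trans[OF plan_cost_mono[OF _ sub[OF k]]]
            order_trans[OF cost] ennreal_leI lo[OF k]) auto
      also have "\<dots> = ennreal (\<theta> k)"
        using card_pos[OF k] assms(2) assms(8)[OF k] by (subst ennreal_mult[symmetric]) auto
      finally show ?thesis using W(1)[OF w] by (simp add: wasserstein_ball_def)
    qed
    moreover have "weighted_sum (borel_on \<Xi>) {1..K} ?p ?Q = Q"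
    proof -
      have "weighted_sum (borel_on \<Xi>) {1..K} (\<lambda>k. real (card (C k)) / real (card (\<Union>k\<in>{1..K}. C k)))
          (\<lambda>k. subplan_marginal Q (\<Union>k\<in>{1..K}. C k) f (C k)) = Q"
      proof (rule weighted_sum_subplan_marginals[OF _ _ _ _ assms(6,7) fin])
        show "semidiscrete_plan Q (\<Union>k\<in>{1..K}. C k) f" unfolding U by (rule f)
      qed (use Q' in \<open>simp_all add: prob_measures_def\<close>)
      then show ?thesis by (simp only: U card_atLeastAtMost diff_Suc_1)
    qed
    ultimately show "Q \<in> ambiguity_set \<Xi> nrm N w K C \<theta>"
      unfolding ambiguity_set_def mem_Collect_eq by (intro exI[of _ ?Q]) auto
  qed
  show "ambiguity_set \<Xi> nrm N w K C \<theta> \<subseteq> wasserstein_ball \<Xi> nrm ?hi (empirical \<Xi> w {1..N})"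
  proof
    fix R assume "R \<in> ambiguity_set \<Xi> nrm N w K C \<theta>"
    then obtain Q where R: "R = weighted_sum (borel_on \<Xi>) {1..K} ?p Q"
      and Q: "\<And>k. k \<in> {1..K} \<Longrightarrow> Q k \<in> wasserstein_ball \<Xi> nrm (\<theta> k) (empirical \<Xi> w (C k))"
      by (auto simp: ambiguity_set_def)
    have hi: "\<theta> k \<le> ?hi" if "k \<in> {1..K}" for k using that by (intro Max_ge) auto
    have one: "1 \<in> {1..K}" using assms(3) by simp
    have "0 \<le> ?hi" using hi[OF one] assms(8)[OF one] by linarith
    moreover have "wasserstein \<Xi> nrm (Q k) (empirical \<Xi> w (C k)) \<le> ennreal ?hi" if "k \<in> {1..K}" for k
      using Q[OF that] order_trans[OF _ ennreal_leI[OF hi[OF that]]] by (simp add: wasserstein_ball_def)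
    \<comment> \<open>Enlarging every cluster radius to \<open>?hi\<close> puts all components under
      one common bound, so that convexity applies.\<close>
    ultimately have "wasserstein \<Xi> nrm R (weighted_sum (borel_on \<Xi>) {1..K} ?p (\<lambda>k. empirical \<Xi> w (C k))) \<le> ennreal ?hi"
      unfolding R by (intro wasserstein_weighted_sum_le p_sum assms(1)) auto
    moreover have "weighted_sum (borel_on \<Xi>) {1..K} ?p (\<lambda>k. empirical \<Xi> w (C k)) = empirical \<Xi> w {1..N}"
      using empirical_UN[OF _ assms(6,7) fin, where \<Xi>=\<Xi> and w=w]
      by (simp only: U card_atLeastAtMost diff_Suc_1 finite_atLeastAtMost)
    moreover have "R \<in> prob_measures \<Xi>"
      using prob_space_weighted_sum[of "{1..K}" Q "borel_on \<Xi>" ?p] Q p_sum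
      by (simp add: R prob_measures_def wasserstein_ball_def)
    ultimately show "R \<in> wasserstein_ball \<Xi> nrm ?hi (empirical \<Xi> w {1..N})"
      by (simp add: wasserstein_ball_def)
  qed
qed

end
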